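(* Let $(M,g)$ be a compact Riemannian manifold with a smooth function $f$ and a constant $\lambda\in\mathbb{R}$ such that $\mathrm{Ric}+\mathrm{Hess} f=\lambda g$. If $\mathrm{Ric}(\nabla f,\nabla f)\le 0$ on $M$, then the gradient soliton $(M,g,f)$ is rigid with trivial $f$; that is, $f$ is constant (and so $g$ is Einstein with $\mathrm{Ric}=\lambda g$).
   Context: Manifolds are connected, without boundary, and all data are smooth. A gradient (Ricci) soliton is $(M,g,f)$ with $\mathrm{Ric}+\mathrm{Hess} f=\lambda g$ for a constant $\lambda$. It is called rigid if, up to isometry and up to adding a constant to $f$, it is of the form $N\times_\Gamma\mathbb{R}^k$, where $k\ge 0$, $N$ is an Einstein manifold with Einstein constant $\lambda$ (possibly a point), $\Gamma$ is a discrete group acting freely (and properly discontinuously by isometries) on $N$ and by orthogonal transformations on $\mathbb{R}^k$, $N\times_\Gamma\mathbb{R}^k$ is the quotient of the Riemannian product by the diagonal action, and $f=\frac{\lambda}{2}d^2$ with $d$ the distance in the flat fibers to the base (the zero section). The case of trivial (constant) $f$ is the case where $g$ itself is Einstein with constant $\lambda$. *)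

theory Defs
  imports "HOL-Analysis.Analysis"
begin

text \<open>Smooth maps between open subsets of Euclidean spaces. Below, \<open>S\<close> is always open.\<close>

primrec Ck_on :: "nat \<Rightarrow> 'a::real_normed_vector set \<Rightarrow> ('a \<Rightarrow> 'b::real_normed_vector) \<Rightarrow> bool" where
  "Ck_on 0 S F \<longleftrightarrow> continuous_on S F"
| "Ck_on (Suc k) S F \<longleftrightarrow>
     (\<forall>x\<in>S. F differentiable (at x)) \<and> (\<forall>v. Ck_on k S (\<lambda>x. frechet_derivative F (at x) v))"

definition smooth_on :: "'a::real_normed_vector set \<Rightarrow> ('a \<Rightarrow> 'b::real_normed_vector) \<Rightarrow> bool" where
  "smooth_on S F \<longleftrightarrow> (\<forall>k. Ck_on k S F)"

definition partial :: "'n \<Rightarrow> (real^'n \<Rightarrow> real) \<Rightarrow> real^'n \<Rightarrow> real" where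
  "partial i F x = frechet_derivative F (at x) (axis i 1)"


section \<open>Smooth manifolds\<close>

text \<open>A chart is a pair \<open>(U, \<phi>)\<close> of a domain and a coordinate map; \<open>\<phi>\<close> is only
  relevant on \<open>U\<close>. The dimension of the manifold is \<open>CARD('n)\<close>.\<close>

type_synonym ('a, 'n) chart = "'a set \<times> ('a \<Rightarrow> real^'n)"

definition chart_image :: "('a, 'n::finite) chart \<Rightarrow> (real^'n) set" where
  "chart_image c = snd c ` fst c"

definition chart_inv :: "('a, 'n::finite) chart \<Rightarrow> real^'n \<Rightarrow> 'a" where
  "chart_inv c = inv_into (fst c) (snd c)"

definition chart_of :: "'a topology \<Rightarrow> ('a, 'n::finite) chart \<Rightarrow> bool" where
  "chart_of X c \<longleftrightarrow> openin X (fst c) \<and> open (chart_image c) \<and>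
     homeomorphic_map (subtopology X (fst c)) (top_of_set (chart_image c)) (snd c)"

definition overlap :: "('a, 'n::finite) chart \<Rightarrow> ('a, 'n) chart \<Rightarrow> (real^'n) set" where
  "overlap c d = snd c ` (fst c \<inter> fst d)"

definition transition :: "('a, 'n::finite) chart \<Rightarrow> ('a, 'n) chart \<Rightarrow> real^'n \<Rightarrow> real^'n" where
  "transition c d = snd d \<circ> chart_inv c"

text \<open>The atlas is not required to be maximal. Manifolds are connected and have no boundary.\<close>

definition smooth_manifold :: "'a topology \<Rightarrow> ('a, 'n::finite) chart set \<Rightarrow> bool" where
  "smooth_manifold X A \<longleftrightarrow>
     Hausdorff_space X \<and> second_countable X \<and> connected_space X \<and>
     (\<forall>c\<in>A. chart_of X c) \<and> (\<Union>c\<in>A. fst c) = topspace X \<and>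
     (\<forall>c\<in>A. \<forall>d\<in>A. smooth_on (overlap c d) (transition c d))"

definition coord_rep :: "('a \<Rightarrow> real) \<Rightarrow> ('a, 'n::finite) chart \<Rightarrow> real^'n \<Rightarrow> real" where
  "coord_rep f c = f \<circ> chart_inv c"

definition smooth_function :: "('a, 'n::finite) chart set \<Rightarrow> ('a \<Rightarrow> real) \<Rightarrow> bool" where
  "smooth_function A f \<longleftrightarrow> (\<forall>c\<in>A. smooth_on (chart_image c) (coord_rep f c))"


section \<open>Riemannian metrics\<close>

text \<open>A metric is given by its component matrices \<open>g c x\<close>, for \<open>c\<close> in the atlas and \<open>x\<close> in the
  image of \<open>c\<close>. The last clause is the transformation law of a covariant 2-tensor.\<close>

definition riemannian_metric ::
  "('a, 'n::finite) chart set \<Rightarrow> (('a, 'n) chart \<Rightarrow> real^'n \<Rightarrow> real^'n^'n) \<Rightarrow> bool" where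
  "riemannian_metric A g \<longleftrightarrow>
     (\<forall>c\<in>A. smooth_on (chart_image c) (g c) \<and>
        (\<forall>x\<in>chart_image c. transpose (g c x) = g c x \<and> (\<forall>v. v \<noteq> 0 \<longrightarrow> v \<bullet> (g c x *v v) > 0))) \<and>
     (\<forall>c\<in>A. \<forall>d\<in>A. \<forall>x\<in>overlap c d.
        let J = matrix (frechet_derivative (transition c d) (at x))
        in g c x = transpose J ** g d (transition c d x) ** J)"

text \<open>The following operators act on a metric \<open>h\<close> and a function \<open>u\<close> given in local coordinates.

  \<open>christoffel h l i j\<close> is the symbol \<open>\<Gamma>\<close> with upper index \<open>l\<close> and lower indices \<open>i\<close>, \<open>j\<close> of the
  Levi-Civita connection of \<open>h\<close>.

  \<open>riemann h l i j k\<close> is the \<open>l\<close>-th component of \<open>R(\<partial>\<^sub>i, \<partial>\<^sub>j) \<partial>\<^sub>k\<close>, where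
  \<open>R(X, Y) = \<nabla>\<^sub>X \<nabla>\<^sub>Y - \<nabla>\<^sub>Y \<nabla>\<^sub>X - \<nabla>\<^bsub>[X, Y]\<^esub>\<close>.

  Ricci is the trace \<open>Ric(Y, Z) = tr (X \<mapsto> R(X, Y) Z)\<close>, which is positive on round spheres.\<close>

definition christoffel ::
  "(real^'n \<Rightarrow> real^'n^'n::finite) \<Rightarrow> 'n \<Rightarrow> 'n \<Rightarrow> 'n \<Rightarrow> real^'n \<Rightarrow> real" where
  "christoffel h l i j x = (\<Sum>m\<in>UNIV. matrix_inv (h x) $ l $ m *
     (partial i (\<lambda>y. h y $ j $ m) x + partial j (\<lambda>y. h y $ i $ m) x
      - partial m (\<lambda>y. h y $ i $ j) x)) / 2"

definition riemann ::
  "(real^'n \<Rightarrow> real^'n^'n::finite) \<Rightarrow> 'n \<Rightarrow> 'n \<Rightarrow> 'n \<Rightarrow> 'n \<Rightarrow> real^'n \<Rightarrow> real" where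
  "riemann h l i j k x =
     partial i (christoffel h l j k) x - partial j (christoffel h l i k) x
     + (\<Sum>m\<in>UNIV. christoffel h l i m x * christoffel h m j k x
                 - christoffel h l j m x * christoffel h m i k x)"

definition ricci :: "(real^'n \<Rightarrow> real^'n^'n::finite) \<Rightarrow> real^'n \<Rightarrow> real^'n^'n" where
  "ricci h x = (\<chi> j k. \<Sum>i\<in>UNIV. riemann h i i j k x)"

definition grad :: "(real^'n \<Rightarrow> real^'n^'n::finite) \<Rightarrow> (real^'n \<Rightarrow> real) \<Rightarrow> real^'n \<Rightarrow> real^'n" where
  "grad h u x = matrix_inv (h x) *v (\<chi> j. partial j u x)"

definition hess :: "(real^'n \<Rightarrow> real^'n^'n::finite) \<Rightarrow> (real^'n \<Rightarrow> real) \<Rightarrow> real^'n \<Rightarrow> real^'n^'n" where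
  "hess h u x = (\<chi> i j. partial i (partial j u) x
     - (\<Sum>k\<in>UNIV. christoffel h k i j x * partial k u x))"


section \<open>Gradient Ricci solitons\<close>

definition gradient_ricci_soliton ::
  "'a topology \<Rightarrow> ('a, 'n::finite) chart set \<Rightarrow> (('a, 'n) chart \<Rightarrow> real^'n \<Rightarrow> real^'n^'n)
     \<Rightarrow> ('a \<Rightarrow> real) \<Rightarrow> real \<Rightarrow> bool" where
  "gradient_ricci_soliton X A g f lam \<longleftrightarrow>
     smooth_manifold X A \<and> riemannian_metric A g \<and> smooth_function A f \<and>
     (\<forall>c\<in>A. \<forall>x\<in>chart_image c. ricci (g c) x + hess (g c) (coord_rep f c) x = lam *\<^sub>R g c x)"

definition einstein ::
  "('a, 'n::finite) chart set \<Rightarrow> (('a, 'n) chart \<Rightarrow> real^'n \<Rightarrow> real^'n^'n) \<Rightarrow> real \<Rightarrow> bool" where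
  "einstein A g lam \<longleftrightarrow> (\<forall>c\<in>A. \<forall>x\<in>chart_image c. ricci (g c) x = lam *\<^sub>R g c x)"

text \<open>The function \<open>Ric(\<nabla>f, \<nabla>f)\<close> in the coordinates of \<open>c\<close>.\<close>

definition ricci_grad ::
  "(('a, 'n::finite) chart \<Rightarrow> real^'n \<Rightarrow> real^'n^'n) \<Rightarrow> ('a \<Rightarrow> real) \<Rightarrow> ('a, 'n) chart \<Rightarrow> real^'n \<Rightarrow> real" where
  "ricci_grad g f c x = (let X = grad (g c) (coord_rep f c) x in X \<bullet> (ricci (g c) x *v X))"

end

theory Submission
  imports Defs
begin

text \<open>
  Put \<open>u = \<bar>\<nabla>f\<bar>\<^sup>2\<close> and \<open>n = dim M\<close>. On a gradient soliton the Bochner formula takes the form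
  \<open>\<Delta>u = 2 (\<bar>Hess f\<bar>\<^sup>2 - Ric(\<nabla>f, \<nabla>f))\<close>, so the sign hypothesis and the Cauchy-Schwarz inequality give
  \<open>\<Delta>u \<ge> 2 \<bar>Hess f\<bar>\<^sup>2 \<ge> 2 (\<Delta>f)\<^sup>2 / n\<close>. Thus \<open>u\<close> is subharmonic, but the maximum principle for \<open>u\<close> alone
  would have to be the strong one. It is replaced by the second derivative test at a maximum of the
  perturbed function \<open>w = u + \<epsilon> f\<^sup>2\<close>, where \<open>\<epsilon> > 0\<close>: since \<open>\<Delta>(f\<^sup>2) = 2 f \<Delta>f + 2 u\<close>, at such a point

    \<open>0 \<ge> \<Delta>w \<ge> 2 (\<Delta>f)\<^sup>2 / n + 2 \<epsilon> f \<Delta>f + 2 \<epsilon> u \<ge> 2 \<epsilon> u - n \<epsilon>\<^sup>2 f\<^sup>2 / 2\<close>,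

  the last step by completing the square in \<open>\<Delta>f\<close>. Hence \<open>u \<le> n \<epsilon> f\<^sup>2 / 4\<close> there
  (\<open>normsq_le_at_max\<close>). If \<open>f\<^sup>2 \<le> C\<close> on the compact \<open>M\<close>, it follows that \<open>u \<le> w \<le> \<epsilon> C (n / 4 + 1)\<close>
  on all of \<open>M\<close>, and \<open>\<epsilon> \<rightarrow> 0\<close> yields \<open>u = 0\<close>. So \<open>f\<close> is locally constant, hence constant, and the
  soliton equation becomes the Einstein equation.

  The Bochner formula rests on three facts. For every function,
  \<open>\<Delta>u = 2 (\<bar>Hess f\<bar>\<^sup>2 + (div Hess f)(\<nabla>f))\<close> (\<open>divg_gradc_normsq\<close>). Commuting covariant derivatives of
  \<open>\<nabla>f\<close> gives \<open>div Hess f = d(\<Delta>f) + Ric(\<nabla>f)\<close> (\<open>div_hessmix_commute\<close>). The contracted second Bianchi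
  identity \<open>d scal = 2 div Ric\<close> (\<open>contracted_bianchi\<close>), applied to \<open>Ric = \<lambda> g - Hess f\<close>, gives
  \<open>d(\<Delta>f) = 2 div Hess f\<close> (\<open>partial_trace_hess\<close>). The last two combine to
  \<open>div Hess f = - Ric(\<nabla>f)\<close>.

  All of this is computed in one chart. Vector fields are families of component functions and
  curvature is the commutator of the operators \<open>\<nabla>\<^sub>p\<close> on them, which turns the second Bianchi identity
  into the Jacobi identity. Charts are compared only once, to see that \<open>u\<close> is a function on \<open>M\<close>.
\<close>

section \<open>Calculus of smooth functions\<close>

lemma frechet_derivative_cong_open:
  assumes "open S" "x \<in> S" "\<And>y. y \<in> S \<Longrightarrow> F y = G y"
  shows "frechet_derivative F (at x) = frechet_derivative G (at x)"
proof -
  have "(F has_derivative D) (at x) \<longleftrightarrow> (G has_derivative D) (at x)" for D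
    using has_derivative_transform_within_open[OF _ assms(1,2)] assms(3) by metis
  then show ?thesis by (simp add: frechet_derivative_def)
qed

lemma differentiable_cong_open:
  assumes "open S" "x \<in> S" "\<And>y. y \<in> S \<Longrightarrow> F y = G y" "F differentiable (at x)"
  shows "G differentiable (at x)"
  using has_derivative_transform_within_open[OF _ assms(1,2)] assms(3,4)
  unfolding differentiable_def by metis

lemma Ck_on_cong:
  assumes "open S" "\<And>x. x \<in> S \<Longrightarrow> F x = G x" "Ck_on k S F"
  shows "Ck_on k S G"
  using assms
proof (induction k arbitrary: F G)
  case 0
  then show ?case by (simp cong: continuous_on_cong)
next
  case (Suc k)
  have "Ck_on k S (\<lambda>x. frechet_derivative G (at x) v)" for v
    using Suc.IH[of "\<lambda>x. frechet_derivative F (at x) v" "\<lambda>x. frechet_derivative G (at x) v"]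
      Suc.prems frechet_derivative_cong_open[of S _ F G] by simp
  then show ?case
    using Suc.prems differentiable_cong_open[of S _ F G] by simp
qed

text \<open>Needed because in the product rule the factors that are not differentiated have to be
  weakened from class \<open>k + 1\<close> to class \<open>k\<close>.\<close>

lemma Ck_on_Suc_imp: "Ck_on (Suc k) S F \<Longrightarrow> Ck_on k S F"
proof (induction k arbitrary: F)
  case 0
  then show ?case
    by (auto intro!: continuous_at_imp_continuous_on differentiable_imp_continuous_within)
next
  case (Suc k)
  then show ?case by (metis Ck_on.simps(2))
qed

lemma frechet_derivative_const_fun: "frechet_derivative (\<lambda>x. c) (at x) = (\<lambda>v. 0)"
  by (metis frechet_derivative_at has_derivative_const)

lemma Ck_on_const: "Ck_on k S (\<lambda>x. c)"
  by (induction k arbitrary: c) (auto simp: frechet_derivative_const_fun)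

lemma frechet_derivative_add_fun:
  assumes "F differentiable (at x)" "G differentiable (at x)"
  shows "frechet_derivative (\<lambda>x. F x + G x) (at x) v = frechet_derivative F (at x) v + frechet_derivative G (at x) v"
  using has_derivative_add[OF assms[unfolded frechet_derivative_works]]
  by (metis frechet_derivative_at)

lemma frechet_derivative_mult_fun:
  fixes F G :: "'a::real_normed_vector \<Rightarrow> real"
  assumes "F differentiable (at x)" "G differentiable (at x)"
  shows "frechet_derivative (\<lambda>x. F x * G x) (at x) v
    = F x * frechet_derivative G (at x) v + frechet_derivative F (at x) v * G x"
  using has_derivative_mult[OF assms[unfolded frechet_derivative_works]]
  by (metis frechet_derivative_at)

lemma frechet_derivative_inverse_fun:
  fixes F :: "'a::real_normed_vector \<Rightarrow> real"
  assumes "F differentiable (at x)" "F x \<noteq> 0"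
  shows "frechet_derivative (\<lambda>x. inverse (F x)) (at x) v
    = (- frechet_derivative F (at x) v) * (inverse (F x) * inverse (F x))"
proof -
  have "((\<lambda>x. inverse (F x)) has_derivative
      (\<lambda>v. - (inverse (F x) * frechet_derivative F (at x) v * inverse (F x)))) (at x)"
    by (rule Deriv.has_derivative_inverse) (use assms in \<open>auto simp: frechet_derivative_works\<close>)
  from frechet_derivative_at[OF this, symmetric] show ?thesis by (simp add: ac_simps)
qed

lemma frechet_derivative_linear_comp:
  assumes "bounded_linear L" "F differentiable (at x)"
  shows "((\<lambda>x. L (F x)) differentiable (at x)) \<and>
    frechet_derivative (\<lambda>x. L (F x)) (at x) v = L (frechet_derivative F (at x) v)"
  using bounded_linear.has_derivative[OF assms(1) assms(2)[unfolded frechet_derivative_works]]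
  by (metis frechet_derivative_at differentiableI)

lemma Ck_on_add:
  assumes "open S" "Ck_on k S F" "Ck_on k S G"
  shows "Ck_on k S (\<lambda>x. F x + G x)"
  using assms
proof (induction k arbitrary: F G)
  case 0
  then show ?case by (auto intro: continuous_on_add continuous_on_mult continuous_on_inverse)
next
  case (Suc k)
  have "Ck_on k S (\<lambda>x. frechet_derivative (\<lambda>x. F x + G x) (at x) v)" for v
    by (rule Ck_on_cong[OF Suc.prems(1) _ Suc.IH[of "\<lambda>x. frechet_derivative F (at x) v" "\<lambda>x. frechet_derivative G (at x) v"]])
      (use Suc.prems in \<open>auto simp: frechet_derivative_add_fun\<close>)
  then show ?case using Suc.prems by (auto intro: differentiable_add)
qed

lemma Ck_on_mult:
  fixes F G :: "'a::real_normed_vector \<Rightarrow> real"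
  assumes "open S" "Ck_on k S F" "Ck_on k S G"
  shows "Ck_on k S (\<lambda>x. F x * G x)"
  using assms
proof (induction k arbitrary: F G)
  case 0
  then show ?case by (auto intro: continuous_on_add continuous_on_mult continuous_on_inverse)
next
  case (Suc k)
  have "Ck_on k S (\<lambda>x. frechet_derivative (\<lambda>x. F x * G x) (at x) v)" for v
    by (rule Ck_on_cong[OF Suc.prems(1) _ Ck_on_add[OF Suc.prems(1) Suc.IH[of F "\<lambda>x. frechet_derivative G (at x) v"]
            Suc.IH[of "\<lambda>x. frechet_derivative F (at x) v" G]]])
      (use Suc.prems Ck_on_Suc_imp[of k S F] Ck_on_Suc_imp[of k S G] in \<open>auto simp: frechet_derivative_mult_fun\<close>)
  then show ?case using Suc.prems by (auto intro: differentiable_mult)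
qed

lemma Ck_on_linear_comp:
  assumes "open S" "bounded_linear L" "Ck_on k S F"
  shows "Ck_on k S (\<lambda>x. L (F x))"
  using assms
proof (induction k arbitrary: F)
  case 0
  then show ?case by (auto intro: bounded_linear.continuous_on)
next
  case (Suc k)
  have "Ck_on k S (\<lambda>x. frechet_derivative (\<lambda>x. L (F x)) (at x) v)" for v
    by (rule Ck_on_cong[OF Suc.prems(1) _ Suc.IH[of "\<lambda>x. frechet_derivative F (at x) v"]])
      (use Suc.prems in \<open>auto simp: frechet_derivative_linear_comp\<close>)
  then show ?case using Suc.prems by (auto simp: frechet_derivative_linear_comp)
qed

lemma Ck_on_inverse:
  fixes F :: "'a::real_normed_vector \<Rightarrow> real"
  assumes "open S" "Ck_on k S F" "\<And>x. x \<in> S \<Longrightarrow> F x \<noteq> 0"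
  shows "Ck_on k S (\<lambda>x. inverse (F x))"
  using assms
proof (induction k)
  case 0
  then show ?case by (auto intro: continuous_on_add continuous_on_mult continuous_on_inverse)
next
  case (Suc k)
  have inv: "Ck_on k S (\<lambda>x. inverse (F x))"
    using Suc Ck_on_Suc_imp[of k S F] by blast
  have "Ck_on k S (\<lambda>x. frechet_derivative (\<lambda>x. inverse (F x)) (at x) v)" for v
  proof -
    have "Ck_on k S (\<lambda>x. (- frechet_derivative F (at x) v) * (inverse (F x) * inverse (F x)))"
      by (intro Ck_on_mult inv Suc.prems Ck_on_linear_comp[OF _ bounded_linear_minus[OF bounded_linear_ident]])
        (use Suc.prems in simp)
    then show ?thesis
      by (rule Ck_on_cong[OF Suc.prems(1), rotated])
        (use Suc.prems in \<open>auto simp: frechet_derivative_inverse_fun\<close>)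
  qed
  then show ?case using Suc.prems by (auto intro: differentiable_inverse)
qed

lemma smooth_on_const: "smooth_on S (\<lambda>x. c)"
  by (simp add: smooth_on_def Ck_on_const)

lemma smooth_on_add: "open S \<Longrightarrow> smooth_on S F \<Longrightarrow> smooth_on S G \<Longrightarrow> smooth_on S (\<lambda>x. F x + G x)"
  by (simp add: smooth_on_def Ck_on_add)

lemma smooth_on_mult:
  fixes F G :: "'a::real_normed_vector \<Rightarrow> real"
  shows "open S \<Longrightarrow> smooth_on S F \<Longrightarrow> smooth_on S G \<Longrightarrow> smooth_on S (\<lambda>x. F x * G x)"
  by (simp add: smooth_on_def Ck_on_mult)

lemma smooth_on_linear_comp:
  "open S \<Longrightarrow> bounded_linear L \<Longrightarrow> smooth_on S F \<Longrightarrow> smooth_on S (\<lambda>x. L (F x))"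
  by (simp add: smooth_on_def Ck_on_linear_comp)

lemma smooth_on_uminus: "open S \<Longrightarrow> smooth_on S F \<Longrightarrow> smooth_on S (\<lambda>x. - F x)"
  by (rule smooth_on_linear_comp[OF _ bounded_linear_minus[OF bounded_linear_ident]])

lemma smooth_on_diff: "open S \<Longrightarrow> smooth_on S F \<Longrightarrow> smooth_on S G \<Longrightarrow> smooth_on S (\<lambda>x. F x - G x)"
  using smooth_on_add[of S F "\<lambda>x. - G x"] smooth_on_uminus[of S G] by simp

lemma smooth_on_inverse:
  fixes F :: "'a::real_normed_vector \<Rightarrow> real"
  shows "open S \<Longrightarrow> smooth_on S F \<Longrightarrow> (\<And>x. x \<in> S \<Longrightarrow> F x \<noteq> 0) \<Longrightarrow> smooth_on S (\<lambda>x. inverse (F x))"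
  by (simp add: smooth_on_def Ck_on_inverse)

lemma smooth_on_cong:
  "open S \<Longrightarrow> (\<And>x. x \<in> S \<Longrightarrow> F x = G x) \<Longrightarrow> smooth_on S F \<Longrightarrow> smooth_on S G"
  unfolding smooth_on_def using Ck_on_cong by blast

lemma smooth_on_sum:
  assumes "open S" "\<And>i. i \<in> I \<Longrightarrow> smooth_on S (F i)"
  shows "smooth_on S (\<lambda>x. \<Sum>i\<in>I. F i x)"
proof (cases "finite I")
  case True
  then show ?thesis using assms(2)
    by (induction I) (auto simp: smooth_on_const intro!: smooth_on_add assms(1))
qed (simp add: smooth_on_const)

lemma smooth_on_prod:
  fixes F :: "'i \<Rightarrow> 'a::real_normed_vector \<Rightarrow> real"
  assumes "open S" "\<And>i. i \<in> I \<Longrightarrow> smooth_on S (F i)"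
  shows "smooth_on S (\<lambda>x. \<Prod>i\<in>I. F i x)"
proof (cases "finite I")
  case True
  then show ?thesis using assms(2)
    by (induction I) (auto simp: smooth_on_const intro!: smooth_on_mult assms(1))
qed (simp add: smooth_on_const)

lemma smooth_on_differentiable: "smooth_on S F \<Longrightarrow> x \<in> S \<Longrightarrow> F differentiable (at x)"
  unfolding smooth_on_def by (metis Ck_on.simps(2))

lemma smooth_on_frechet_derivative:
  "smooth_on S F \<Longrightarrow> smooth_on S (\<lambda>x. frechet_derivative F (at x) v)"
  unfolding smooth_on_def by (metis Ck_on.simps(2))

lemma smooth_on_partial: "smooth_on S F \<Longrightarrow> smooth_on S (partial i F)"
  using smooth_on_frechet_derivative[of S F "axis i 1"] by (simp add: partial_def[abs_def])

lemma smooth_on_continuous_on: "smooth_on S F \<Longrightarrow> continuous_on S F"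
  unfolding smooth_on_def by (metis Ck_on.simps(1))

lemma smooth_on_det:
  assumes "open S" "\<And>i j. smooth_on S (\<lambda>x. M x $ i $ j)"
  shows "smooth_on S (\<lambda>x. det (M x :: real^'n^'n))"
  unfolding det_def
  by (intro smooth_on_sum smooth_on_mult smooth_on_prod smooth_on_const assms)

lemma matrix_inv_left_right:
  assumes "det (M :: real^'n^'n) \<noteq> 0"
  shows "matrix_inv M ** M = mat 1" "M ** matrix_inv M = mat 1"
proof -
  have "M ** matrix_inv M = mat 1 \<and> matrix_inv M ** M = mat 1"
    unfolding matrix_inv_def
    by (rule someI_ex) (use assms in \<open>auto simp: invertible_det_nz[symmetric] invertible_def\<close>)
  then show "matrix_inv M ** M = mat 1" "M ** matrix_inv M = mat 1" by auto
qed

text \<open>By Cramer's rule the entries of the inverse are quotients of determinants, and these are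
  polynomials in the entries.\<close>

lemma smooth_on_matrix_inv:
  assumes "open S" "\<And>i j. smooth_on S (\<lambda>x. M x $ i $ j)" "\<And>x. x \<in> S \<Longrightarrow> det (M x :: real^'n^'n) \<noteq> 0"
  shows "smooth_on S (\<lambda>x. matrix_inv (M x) $ k $ l)"
proof -
  define N where "N = (\<lambda>x. (\<chi> i j. if j = k then axis l 1 $ i else M x $ i $ j) :: real^'n^'n)"
  have "smooth_on S (\<lambda>x. det (N x) * inverse (det (M x)))"
  proof (intro smooth_on_mult smooth_on_inverse smooth_on_det assms)
    show "smooth_on S (\<lambda>x. N x $ i $ j)" for i j
      by (cases "j = k") (auto simp: N_def smooth_on_const assms(2))
  qed
  then show ?thesis
  proof (rule smooth_on_cong[OF assms(1), rotated])
    fix x assume "x \<in> S"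
    then have nz: "det (M x) \<noteq> 0" by (rule assms(3))
    have "M x *v (matrix_inv (M x) *v axis l 1) = axis l 1"
      using matrix_inv_left_right[OF nz] by (simp add: matrix_vector_mul_assoc)
    then have "(matrix_inv (M x) *v axis l 1) $ k = det (N x) / det (M x)"
      using cramer[OF nz] by (simp add: N_def)
    then show "det (N x) * inverse (det (M x)) = matrix_inv (M x) $ k $ l"
      by (simp add: divide_inverse matrix_vector_mul_component inner_axis)
  qed
qed

lemma smooth_on_component:
  "open S \<Longrightarrow> smooth_on S F \<Longrightarrow> smooth_on S (\<lambda>x. F x $ i)"
  by (rule smooth_on_linear_comp[OF _ bounded_linear_vec_nth])

lemma partial_cong_open:
  assumes "open S" "x \<in> S" "\<And>y. y \<in> S \<Longrightarrow> F y = G y"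
  shows "partial i F x = partial i G x"
  using frechet_derivative_cong_open[of S x F G] assms by (simp add: partial_def)

lemma partial_const: "partial i (\<lambda>x. c) x = 0"
  by (simp add: partial_def frechet_derivative_const_fun)

lemma partial_add:
  assumes "smooth_on S F" "smooth_on S G" "x \<in> S"
  shows "partial i (\<lambda>x. F x + G x) x = partial i F x + partial i G x"
  using assms by (simp add: partial_def frechet_derivative_add_fun smooth_on_differentiable)

lemma partial_mult:
  assumes "smooth_on S F" "smooth_on S G" "x \<in> S"
  shows "partial i (\<lambda>x. F x * G x) x = F x * partial i G x + partial i F x * G x"
  using assms by (simp add: partial_def frechet_derivative_mult_fun smooth_on_differentiable)

lemma partial_uminus:
  assumes "smooth_on S F" "x \<in> S"
  shows "partial i (\<lambda>x. - F x) x = - partial i F x"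
  using assms frechet_derivative_linear_comp[OF bounded_linear_minus[OF bounded_linear_ident], of F x]
  by (simp add: partial_def smooth_on_differentiable)

lemma partial_diff:
  assumes "open S" "smooth_on S F" "smooth_on S G" "x \<in> S"
  shows "partial i (\<lambda>x. F x - G x) x = partial i F x - partial i G x"
  using partial_add[of S F "\<lambda>x. - G x" x i] partial_uminus[of S G x i] assms
  by (simp add: smooth_on_uminus)

lemma partial_sum:
  assumes "open S" "\<And>i. i \<in> I \<Longrightarrow> smooth_on S (F i)" "x \<in> S"
  shows "partial k (\<lambda>x. \<Sum>i\<in>I. F i x) x = (\<Sum>i\<in>I. partial k (F i) x)"
proof (cases "finite I")
  case True
  then show ?thesis using assms(2)
  proof (induction I)
    case (insert i I)
    then show ?case
      using partial_add[of S "F i" "\<lambda>x. \<Sum>i\<in>I. F i x" x k] assms(1,3) by (simp add: smooth_on_sum)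
  qed (simp add: partial_const)
qed (simp add: partial_const)

lemma DERIV_along_line:
  assumes "F differentiable (at (x + t *\<^sub>R v))"
  shows "((\<lambda>t. F (x + t *\<^sub>R v)) has_real_derivative frechet_derivative F (at (x + t *\<^sub>R v)) v) (at t)"
proof -
  have "((\<lambda>t. x + t *\<^sub>R v) has_derivative (\<lambda>s. s *\<^sub>R v)) (at t)"
    by (auto intro!: derivative_eq_intros)
  from diff_chain_at[OF this, of F] assms[unfolded frechet_derivative_works]
  have D: "((\<lambda>t. F (x + t *\<^sub>R v)) has_derivative (\<lambda>s. frechet_derivative F (at (x + t *\<^sub>R v)) (s *\<^sub>R v))) (at t)"
    by (simp add: o_def)
  have lin: "linear (frechet_derivative F (at (x + t *\<^sub>R v)))"
    using assms linear_frechet_derivative by blast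
  show ?thesis using D
    by (simp add: has_field_derivative_def linear_cmul[OF lin] mult.commute[of _ "frechet_derivative F (at (x + t *\<^sub>R v)) v"])
qed

text \<open>The mean value theorem, first in the direction \<open>u\<close> and then in the direction \<open>v\<close>. The left-hand
  side is symmetric in \<open>u\<close> and \<open>v\<close>, from which the symmetry of second derivatives follows by continuity.\<close>

lemma difference_quotient_mean_value:
  fixes F :: "'a::real_normed_vector \<Rightarrow> real"
  assumes F: "smooth_on S F" and s: "0 < s"
    and S: "\<And>a b. \<lbrakk>0 \<le> a; a \<le> s; 0 \<le> b; b \<le> s\<rbrakk> \<Longrightarrow> x + a *\<^sub>R u + b *\<^sub>R v \<in> S"
  shows "\<exists>a b. 0 < a \<and> a < s \<and> 0 < b \<and> b < s \<and>
    F (x + s *\<^sub>R u + s *\<^sub>R v) - F (x + s *\<^sub>R u) - F (x + s *\<^sub>R v) + F x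
    = s * s * frechet_derivative (\<lambda>y. frechet_derivative F (at y) u) (at (x + a *\<^sub>R u + b *\<^sub>R v)) v"
proof -
  let ?D = "\<lambda>y. frechet_derivative F (at y) u"
  have d1: "((\<lambda>t. F ((x + s *\<^sub>R v) + t *\<^sub>R u) - F (x + t *\<^sub>R u)) has_real_derivative
      ?D (x + s *\<^sub>R v + t *\<^sub>R u) - ?D (x + t *\<^sub>R u)) (at t)" if "0 \<le> t" "t \<le> s" for t
    using S[of t s] S[of t 0] that s
    by (intro DERIV_diff DERIV_along_line smooth_on_differentiable[OF F]) (auto simp: algebra_simps)
  from MVT2[OF s, of "\<lambda>t. F ((x + s *\<^sub>R v) + t *\<^sub>R u) - F (x + t *\<^sub>R u)", OF d1]
  obtain a where a: "0 < a" "a < s" and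
    e1: "F ((x + s *\<^sub>R v) + s *\<^sub>R u) - F (x + s *\<^sub>R u) - (F (x + s *\<^sub>R v) - F x)
      = s * (?D (x + s *\<^sub>R v + a *\<^sub>R u) - ?D (x + a *\<^sub>R u))" by auto
  have d2: "((\<lambda>t. ?D ((x + a *\<^sub>R u) + t *\<^sub>R v)) has_real_derivative
      frechet_derivative ?D (at (x + a *\<^sub>R u + t *\<^sub>R v)) v) (at t)" if "0 \<le> t" "t \<le> s" for t
    using S[of a t] a that
    by (intro DERIV_along_line smooth_on_differentiable[OF smooth_on_frechet_derivative[OF F]]) auto
  from MVT2[OF s, of "\<lambda>t. ?D ((x + a *\<^sub>R u) + t *\<^sub>R v)", OF d2]
  obtain b where b: "0 < b" "b < s" and
    e2: "?D (x + a *\<^sub>R u + s *\<^sub>R v) - ?D (x + a *\<^sub>R u)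
       = s * frechet_derivative ?D (at (x + a *\<^sub>R u + b *\<^sub>R v)) v" by auto
  show ?thesis
    using a b e1 e2 by (intro exI[of _ a] exI[of _ b]) (simp add: algebra_simps)
qed

lemma frechet_derivative_commute:
  fixes F :: "'a::real_normed_vector \<Rightarrow> real"
  assumes S: "open S" "x \<in> S" and F: "smooth_on S F"
  shows "frechet_derivative (\<lambda>y. frechet_derivative F (at y) u) (at x) v
       = frechet_derivative (\<lambda>y. frechet_derivative F (at y) v) (at x) u"
proof -
  let ?P = "\<lambda>y. frechet_derivative (\<lambda>y. frechet_derivative F (at y) u) (at y) v"
  let ?Q = "\<lambda>y. frechet_derivative (\<lambda>y. frechet_derivative F (at y) v) (at y) u"
  have "smooth_on S ?P" "smooth_on S ?Q" by (intro smooth_on_frechet_derivative F)+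
  then have cont: "continuous (at x) ?P" "continuous (at x) ?Q"
    using S smooth_on_continuous_on continuous_on_eq_continuous_at by blast+
  have "\<bar>?P x - ?Q x\<bar> < e + e" if e: "e > 0" for e
  proof -
    obtain d1 where d1: "d1 > 0" "\<And>y. dist y x < d1 \<Longrightarrow> dist (?P y) (?P x) < e"
      using cont(1) e unfolding continuous_at_eps_delta by (metis dist_real_def)
    obtain d2 where d2: "d2 > 0" "\<And>y. dist y x < d2 \<Longrightarrow> dist (?Q y) (?Q x) < e"
      using cont(2) e unfolding continuous_at_eps_delta by (metis dist_real_def)
    obtain d3 where d3: "d3 > 0" "ball x d3 \<subseteq> S" using S open_contains_ball by blast
    define d where "d = min d1 (min d2 d3)"
    define K where "K = norm u + norm v + 1"
    define s where "s = d / (2 * K)"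
    have d: "d > 0" using d1 d2 d3 by (simp add: d_def)
    have np: "K > 0" unfolding K_def by (smt (verit) norm_ge_zero)
    have s: "s > 0" using d np by (simp add: s_def)
    have near: "dist (x + a *\<^sub>R u + b *\<^sub>R v) x < d" if "0 \<le> a" "a \<le> s" "0 \<le> b" "b \<le> s" for a b
    proof -
      have "dist (x + a *\<^sub>R u + b *\<^sub>R v) x \<le> norm (a *\<^sub>R u) + norm (b *\<^sub>R v)"
        using norm_triangle_ineq[of "a *\<^sub>R u" "b *\<^sub>R v"] by (simp add: dist_norm add.assoc)
      also have "\<dots> \<le> s * norm u + s * norm v"
        using that by (simp add: add_mono mult_right_mono)
      also have "\<dots> \<le> s * K" using s by (simp add: K_def algebra_simps)
      also have "\<dots> < d" using np d by (simp add: s_def)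
      finally show ?thesis .
    qed
    have inS: "x + a *\<^sub>R u + b *\<^sub>R v \<in> S" "x + b *\<^sub>R v + a *\<^sub>R u \<in> S"
      if "0 \<le> a" "a \<le> s" "0 \<le> b" "b \<le> s" for a b
      using near[OF that] d3(2) by (auto simp: d_def dist_commute algebra_simps)
    obtain a b where ab: "0 < a" "a < s" "0 < b" "b < s"
      and 1: "F (x + s *\<^sub>R u + s *\<^sub>R v) - F (x + s *\<^sub>R u) - F (x + s *\<^sub>R v) + F x
        = s * s * ?P (x + a *\<^sub>R u + b *\<^sub>R v)"
      using difference_quotient_mean_value[OF F s, of x u v] inS(1) by blast
    obtain a' b' where ab': "0 < a'" "a' < s" "0 < b'" "b' < s"
      and 2: "F (x + s *\<^sub>R v + s *\<^sub>R u) - F (x + s *\<^sub>R v) - F (x + s *\<^sub>R u) + F x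
        = s * s * ?Q (x + a' *\<^sub>R v + b' *\<^sub>R u)"
      using difference_quotient_mean_value[OF F s, of x v u] inS(2) by blast
    have eq: "s * s * ?P (x + a *\<^sub>R u + b *\<^sub>R v) = s * s * ?Q (x + a' *\<^sub>R v + b' *\<^sub>R u)"
      using 1 2 by (simp add: algebra_simps)
    then have eq: "?P (x + a *\<^sub>R u + b *\<^sub>R v) = ?Q (x + a' *\<^sub>R v + b' *\<^sub>R u)"
      using s by simp
    have "dist (?P (x + a *\<^sub>R u + b *\<^sub>R v)) (?P x) < e"
      using near[of a b] ab by (intro d1) (simp add: d_def)
    moreover have "dist (?Q (x + a' *\<^sub>R v + b' *\<^sub>R u)) (?Q x) < e"
      using near[of b' a'] ab' by (intro d2) (simp add: d_def algebra_simps)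
    ultimately show ?thesis using eq by (simp add: dist_real_def abs_if split: if_splits)
  qed
  then have "\<bar>?P x - ?Q x\<bar> \<le> 0"
    by (metis field_le_epsilon add.left_neutral field_sum_of_halves half_gt_zero less_eq_real_def)
  then show ?thesis by simp
qed

lemma partial_commute:
  assumes "open S" "x \<in> S" "smooth_on S F"
  shows "partial i (partial j F) x = partial j (partial i F) x"
  using frechet_derivative_commute[OF assms, of "axis j 1" "axis i 1"]
  by (simp add: partial_def[abs_def])

section \<open>Semidefinite matrices and the second derivative test\<close>

lemma double_sum_insert:
  assumes "finite S" "s \<notin> S"
  shows "(\<Sum>i\<in>insert s S. \<Sum>j\<in>insert s S. G i j)
    = G s s + (\<Sum>j\<in>S. G s j) + (\<Sum>i\<in>S. G i s) + (\<Sum>i\<in>S. \<Sum>j\<in>S. G i j :: real)"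
  using assms by (simp add: sum.distrib)

text \<open>The trace of the product of two positive semidefinite matrices is nonnegative. The proof completes
  squares: one step of the Cholesky decomposition splits off from \<open>A\<close> the rank one matrix built from its
  row \<open>s\<close>, which is paired with \<open>N\<close> directly, and leaves a Schur complement on the smaller index set.\<close>

lemma sum_mult_psd_nonneg:
  fixes A N :: "'i \<Rightarrow> 'i \<Rightarrow> real"
  assumes "finite S" and "\<And>i j. A i j = A j i"
    and "\<And>v. 0 \<le> (\<Sum>i\<in>S. \<Sum>j\<in>S. A i j * v i * v j)"
    and "\<And>v. 0 \<le> (\<Sum>i\<in>S. \<Sum>j\<in>S. N i j * v i * v j)"
  shows "0 \<le> (\<Sum>i\<in>S. \<Sum>j\<in>S. A i j * N i j)"
  using assms
proof (induction S arbitrary: A)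
  case empty
  then show ?case by simp
next
  case (insert s S)
  have eqS: "(\<Sum>j\<in>S. G j (if j = s then t else y j)) = (\<Sum>j\<in>S. G j (y j))" for G :: "'i \<Rightarrow> real \<Rightarrow> real" and t y
    by (rule sum.cong) (use insert.hyps in auto)
  have restr: "(\<Sum>i\<in>S. \<Sum>j\<in>S. B i j * (if i = s then t else y i) * (if j = s then t else y j))
      = (\<Sum>i\<in>S. \<Sum>j\<in>S. B i j * y i * y j)" for B :: "'i \<Rightarrow> 'i \<Rightarrow> real" and t y
    by (intro sum.cong refl) (use insert.hyps in auto)
  have Q: "0 \<le> A s s * t * t + 2 * t * (\<Sum>j\<in>S. A s j * y j) + (\<Sum>i\<in>S. \<Sum>j\<in>S. A i j * y i * y j)" for t y
  proof -
    have "0 \<le> (\<Sum>i\<in>insert s S. \<Sum>j\<in>insert s S. A i j * (if i = s then t else y i) * (if j = s then t else y j))"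
      by (rule insert.prems)
    also have "\<dots> = A s s * t * t + (\<Sum>j\<in>S. A s j * t * y j) + (\<Sum>i\<in>S. A i s * y i * t)
        + (\<Sum>i\<in>S. \<Sum>j\<in>S. A i j * y i * y j)"
      using eqS[of "\<lambda>j z. A s j * t * z" t y] eqS[of "\<lambda>j z. A j s * z * t" t y]
      by (simp only: double_sum_insert[OF insert.hyps(1,2)] restr) simp
    also have "(\<Sum>i\<in>S. A i s * y i * t) = (\<Sum>j\<in>S. A s j * t * y j)"
      by (rule sum.cong) (auto simp: insert.prems(1))
    also have "(\<Sum>j\<in>S. A s j * t * y j) = t * (\<Sum>j\<in>S. A s j * y j)"
      by (simp add: sum_distrib_left ac_simps)
    finally show ?thesis by simp
  qed
  have NS: "0 \<le> (\<Sum>i\<in>S. \<Sum>j\<in>S. N i j * y i * y j)" for y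
  proof -
    have "0 \<le> (\<Sum>i\<in>insert s S. \<Sum>j\<in>insert s S. N i j * (if i = s then 0 else y i) * (if j = s then 0 else y j))"
      by (rule insert.prems)
    also have "\<dots> = (\<Sum>i\<in>S. \<Sum>j\<in>S. N i j * y i * y j)"
      by (simp only: double_sum_insert[OF insert.hyps(1,2)] restr) simp
    finally show ?thesis .
  qed
  have a: "0 \<le> A s s" using Q[of 1 "\<lambda>_. 0"] by simp
  show ?case
  proof (cases "A s s = 0")
    case True
    \<comment> \<open>A vanishing diagonal entry of a semidefinite form forces its row to vanish: otherwise the form
      would be affine and nonconstant in the coordinate \<open>t\<close> of \<open>s\<close>.\<close>
    have z: "A s j = 0" if "j \<in> S" for j
    proof (rule ccontr)
      assume nz: "A s j \<noteq> 0"
      have "(\<Sum>i\<in>S. \<Sum>k\<in>S. A i k * of_bool (i = j) * of_bool (k = j))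
          = (\<Sum>i\<in>S. if i = j then \<Sum>k\<in>S. if k = j then A j j else 0 else 0)"
        by (auto intro!: sum.cong)
      then have 1: "(\<Sum>i\<in>S. \<Sum>k\<in>S. A i k * of_bool (i = j) * of_bool (k = j)) = A j j"
        using that insert.hyps(1) by simp
      have "(\<Sum>k\<in>S. A s k * of_bool (k = j)) = (\<Sum>k\<in>S. if k = j then A s j else 0)"
        by (auto intro!: sum.cong)
      then have "0 \<le> 2 * t * A s j + A j j" for t
        using Q[of t "\<lambda>i. of_bool (i = j)"] that insert.hyps(1) True 1 by simp
      from this[of "- (A j j + 1) / (2 * A s j)"] nz show False by (simp add: field_simps)
    qed
    then have "0 \<le> (\<Sum>i\<in>S. \<Sum>j\<in>S. A i j * N i j)"
      using insert.IH[OF insert.prems(1) _ NS] Q[of 0] True by simp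
    moreover have "(\<Sum>i\<in>S. A i s * N i s) = 0" "(\<Sum>j\<in>S. A s j * N s j) = 0"
      using z insert.prems(1) by (auto intro!: sum.neutral)
    ultimately show ?thesis
      using True by (simp add: double_sum_insert[OF insert.hyps(1,2)])
  next
    case False
    with a have a: "A s s > 0" by simp
    \<comment> \<open>The Schur complement of the entry at \<open>s\<close>.\<close>
    let ?A = "\<lambda>i j. A i j - A s i * A s j / A s s"
    have "0 \<le> (\<Sum>i\<in>S. \<Sum>j\<in>S. ?A i j * y i * y j)" for y
    proof -
      let ?b = "\<Sum>j\<in>S. A s j * y j"
      have "(\<Sum>i\<in>S. \<Sum>j\<in>S. ?A i j * y i * y j)
          = (\<Sum>i\<in>S. \<Sum>j\<in>S. A i j * y i * y j) - ?b * ?b / A s s"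
        by (simp add: left_diff_distrib right_diff_distrib sum_subtractf sum_product sum_divide_distrib ac_simps)
      moreover have "0 \<le> (\<Sum>i\<in>S. \<Sum>j\<in>S. A i j * y i * y j) - ?b * ?b / A s s"
        using Q[of "- ?b / A s s" y] a by (simp add: field_simps)
      ultimately show ?thesis by simp
    qed
    then have 1: "0 \<le> (\<Sum>i\<in>S. \<Sum>j\<in>S. ?A i j * N i j)"
      by (intro insert.IH NS) (auto simp: insert.prems(1) ac_simps)
    have "0 \<le> (\<Sum>i\<in>insert s S. \<Sum>j\<in>insert s S. N i j * A s i * A s j)"
      by (rule insert.prems)
    also have "\<dots> = N s s * A s s * A s s + A s s * (\<Sum>j\<in>S. A s j * N s j) + A s s * (\<Sum>i\<in>S. A s i * N i s)
        + (\<Sum>i\<in>S. \<Sum>j\<in>S. N i j * A s i * A s j)"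
      by (simp only: double_sum_insert[OF insert.hyps(1,2)]) (simp add: sum_distrib_left ac_simps)
    finally have "0 \<le> \<dots> / A s s" using a by simp
    also have "\<dots> = A s s * N s s + (\<Sum>j\<in>S. A s j * N s j) + (\<Sum>i\<in>S. A s i * N i s)
        + (\<Sum>i\<in>S. \<Sum>j\<in>S. N i j * A s i * A s j) / A s s"
      using a by (simp add: field_simps)
    finally have 2: "0 \<le> \<dots>" .
    have 3: "(\<Sum>i\<in>S. \<Sum>j\<in>S. ?A i j * N i j)
        = (\<Sum>i\<in>S. \<Sum>j\<in>S. A i j * N i j) - (\<Sum>i\<in>S. \<Sum>j\<in>S. N i j * A s i * A s j) / A s s"
      by (simp add: left_diff_distrib right_diff_distrib sum_subtractf sum_divide_distrib ac_simps)
    have 4: "(\<Sum>i\<in>S. A i s * N i s) = (\<Sum>i\<in>S. A s i * N i s)"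
      by (rule sum.cong) (auto simp: insert.prems(1))
    show ?thesis
      using 1 2 3 4 by (simp only: double_sum_insert[OF insert.hyps(1,2)])
  qed
qed

lemma frechet_derivative_eq_sum_partial:
  fixes F :: "real^'n \<Rightarrow> real"
  assumes "F differentiable (at x)"
  shows "frechet_derivative F (at x) v = (\<Sum>i\<in>UNIV. v $ i * partial i F x)"
proof -
  have lin: "linear (frechet_derivative F (at x))" using assms linear_frechet_derivative by blast
  have "frechet_derivative F (at x) v = frechet_derivative F (at x) (\<Sum>i\<in>UNIV. v $ i *s axis i 1)"
    by (simp add: basis_expansion)
  also have "\<dots> = (\<Sum>i\<in>UNIV. v $ i * frechet_derivative F (at x) (axis i 1))"
    by (simp add: linear_sum[OF lin] scalar_mult_eq_scaleR linear_cmul[OF lin])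
  finally show ?thesis by (simp add: partial_def)
qed

lemma local_max_derivatives:
  fixes W :: "'a::real_normed_vector \<Rightarrow> real"
  assumes S: "open S" "x \<in> S" and W: "smooth_on S W" and max: "\<And>y. y \<in> S \<Longrightarrow> W y \<le> W x"
  shows "frechet_derivative W (at x) v = 0"
    and "frechet_derivative (\<lambda>y. frechet_derivative W (at y) v) (at x) v \<le> 0"
proof -
  let ?D = "\<lambda>y. frechet_derivative W (at y) v"
  have "frechet_derivative W (at x) = (\<lambda>v. 0)"
    by (rule differential_zero_maxmin[of x S W])
       (use S max smooth_on_differentiable[OF W S(2)] in \<open>auto simp: frechet_derivative_works\<close>)
  then show 0: "frechet_derivative W (at x) v = 0" by simp
  show "frechet_derivative ?D (at x) v \<le> 0"
  proof (rule ccontr)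
    assume "\<not> ?thesis"
    then have pos: "0 < frechet_derivative ?D (at x) v" by simp
    have "((\<lambda>t. ?D (x + t *\<^sub>R v)) has_real_derivative frechet_derivative ?D (at x) v) (at 0)"
      using DERIV_along_line[of ?D x 0 v] smooth_on_differentiable[OF smooth_on_frechet_derivative[OF W] S(2)]
      by simp
    from DERIV_pos_inc_right[OF this pos] obtain d where d: "d > 0"
      and inc: "\<And>t. 0 < t \<Longrightarrow> t < d \<Longrightarrow> 0 < ?D (x + t *\<^sub>R v)"
      using 0 by auto
    obtain r where r: "r > 0" "ball x r \<subseteq> S" using S open_contains_ball by blast
    define K where "K = norm v + 1"
    define s where "s = min (d / 2) (r / (2 * K))"
    have np: "K > 0" unfolding K_def by (smt (verit) norm_ge_zero)
    have s: "s > 0" "s < d" using d r np by (auto simp: s_def min_def field_simps)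
    have inS: "x + t *\<^sub>R v \<in> S" if "0 \<le> t" "t \<le> s" for t
    proof -
      have "norm (t *\<^sub>R v) \<le> s * K" using that by (simp add: mult_mono K_def)
      also have "\<dots> \<le> r / (2 * K) * K"
        using np by (intro mult_right_mono) (auto simp: s_def)
      also have "\<dots> < r" using np r by simp
      finally show ?thesis using r(2) by (auto simp: dist_norm)
    qed
    have "((\<lambda>t. W (x + t *\<^sub>R v)) has_real_derivative ?D (x + t *\<^sub>R v)) (at t)" if "0 \<le> t" "t \<le> s" for t
      by (rule DERIV_along_line[OF smooth_on_differentiable[OF W inS[OF that]]])
    from MVT2[OF s(1) this] obtain t where "0 < t" "t < s"
      "W (x + s *\<^sub>R v) - W x = s * ?D (x + t *\<^sub>R v)" by auto
    with inc[of t] s have "W (x + s *\<^sub>R v) > W x" by (smt (verit) mult_pos_pos)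
    with max[OF inS[of s]] s show False by simp
  qed
qed

lemma local_max_hessian:
  fixes W :: "real^'n \<Rightarrow> real"
  assumes S: "open S" "x \<in> S" and W: "smooth_on S W" and max: "\<And>y. y \<in> S \<Longrightarrow> W y \<le> W x"
  shows "partial i W x = 0"
    and "(\<Sum>i\<in>UNIV. \<Sum>j\<in>UNIV. partial i (partial j W) x * v i * v j) \<le> 0"
proof -
  show "partial i W x = 0"
    using local_max_derivatives(1)[OF assms] by (simp add: partial_def)
  let ?v = "\<chi> i. v i"
  have "frechet_derivative (\<lambda>y. frechet_derivative W (at y) ?v) (at x) ?v
      = (\<Sum>i\<in>UNIV. v i * partial i (\<lambda>y. frechet_derivative W (at y) ?v) x)"
    using frechet_derivative_eq_sum_partial[OF smooth_on_differentiable[OF smooth_on_frechet_derivative[OF W] S(2)]]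
    by simp
  also have "\<dots> = (\<Sum>i\<in>UNIV. v i * partial i (\<lambda>y. \<Sum>j\<in>UNIV. v j * partial j W y) x)"
    using frechet_derivative_eq_sum_partial[OF smooth_on_differentiable[OF W], of _ ?v]
    by (intro sum.cong refl arg_cong2[of _ _ _ _ "(*)"] partial_cong_open[OF S]) simp
  also have "\<dots> = (\<Sum>i\<in>UNIV. v i * (\<Sum>j\<in>UNIV. v j * partial i (partial j W) x))"
    using S W by (simp add: partial_sum[of S] smooth_on_mult smooth_on_const smooth_on_partial
        partial_mult[of S] partial_const)
  finally show "(\<Sum>i\<in>UNIV. \<Sum>j\<in>UNIV. partial i (partial j W) x * v i * v j) \<le> 0"
    using local_max_derivatives(2)[OF assms, of ?v] by (simp add: sum_distrib_left ac_simps)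
qed

section \<open>Curvature in a chart\<close>

lemma sum_kronecker:
  fixes f :: "'n::finite \<Rightarrow> real"
  shows "(\<Sum>m\<in>UNIV. of_bool (k = m) * f m) = f k" "(\<Sum>m\<in>UNIV. of_bool (m = k) * f m) = f k"
    "(\<Sum>m\<in>UNIV. f m * of_bool (k = m)) = f k" "(\<Sum>m\<in>UNIV. f m * of_bool (m = k)) = f k"
proof -
  have "(\<Sum>m\<in>UNIV. of_bool (k = m) * f m) = (\<Sum>m\<in>UNIV. if k = m then f m else 0)"
    by (rule sum.cong) auto
  then show 1: "(\<Sum>m\<in>UNIV. of_bool (k = m) * f m) = f k" by simp
  then show "(\<Sum>m\<in>UNIV. of_bool (m = k) * f m) = f k" by (simp only: eq_commute)
  then show "(\<Sum>m\<in>UNIV. f m * of_bool (k = m)) = f k" "(\<Sum>m\<in>UNIV. f m * of_bool (m = k)) = f k"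
    using 1 by (simp_all only: mult.commute)
qed

text \<open>Everything local happens for a metric \<open>h\<close> on an open set \<open>U\<close> of coordinates.\<close>

locale metric_chart =
  fixes U :: "(real^'n::finite) set" and h :: "real^'n \<Rightarrow> real^'n^'n"
  assumes open_U: "open U" and smooth_h: "smooth_on U h"
    and sym_h: "x \<in> U \<Longrightarrow> transpose (h x) = h x"
    and pos_h: "x \<in> U \<Longrightarrow> v \<noteq> 0 \<Longrightarrow> v \<bullet> (h x *v v) > 0"
begin

abbreviation "Gam \<equiv> christoffel h"

definition cometric :: "'n \<Rightarrow> 'n \<Rightarrow> real^'n \<Rightarrow> real" where
  "cometric i j x = matrix_inv (h x) $ i $ j"

lemma det_h: "x \<in> U \<Longrightarrow> det (h x) \<noteq> 0"
proof -
  assume x: "x \<in> U"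
  have "v = 0" if "h x *v v = 0" for v
    using pos_h[OF x, of v] that by (cases "v = 0") auto
  then have "invertible (h x)"
    using matrix_left_invertible_ker[of "h x"] invertible_left_inverse[of "h x"] by blast
  then show ?thesis by (simp add: invertible_det_nz)
qed

lemma h_sym: "x \<in> U \<Longrightarrow> h x $ i $ j = h x $ j $ i"
  using arg_cong[OF sym_h, of x "\<lambda>M. M $ j $ i"] by (simp add: transpose_def)

lemma matrix_inv_sym: "x \<in> U \<Longrightarrow> transpose (matrix_inv (h x)) = matrix_inv (h x)"
proof -
  assume x: "x \<in> U"
  note I = matrix_inv_left_right[OF det_h[OF x]]
  have "transpose (matrix_inv (h x)) ** h x = mat 1"
    using arg_cong[OF I(2), of transpose] by (simp add: matrix_transpose_mul sym_h[OF x] transpose_mat)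
  then have "transpose (matrix_inv (h x)) ** h x ** matrix_inv (h x) = matrix_inv (h x)"
    by (simp add: matrix_mul_lid)
  then show ?thesis by (simp add: I matrix_mul_rid matrix_mul_assoc[symmetric])
qed

lemma cometric_sym: "x \<in> U \<Longrightarrow> cometric i j x = cometric j i x"
  using arg_cong[OF matrix_inv_sym, of x "\<lambda>M. M $ j $ i"] by (simp add: cometric_def transpose_def)

lemma h_cometric: "x \<in> U \<Longrightarrow> (\<Sum>m\<in>UNIV. h x $ i $ m * cometric m j x) = of_bool (i = j)"
  using matrix_inv_left_right(2)[OF det_h[of x]]
  by (simp add: matrix_matrix_mult_def vec_eq_iff mat_def cometric_def)

lemma cometric_psd: "x \<in> U \<Longrightarrow> 0 \<le> (\<Sum>i\<in>UNIV. \<Sum>j\<in>UNIV. cometric i j x * v i * v j)"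
proof -
  assume x: "x \<in> U"
  let ?v = "\<chi> i. v i" let ?w = "matrix_inv (h x) *v ?v"
  have "h x *v ?w = ?v"
    by (simp add: matrix_vector_mul_assoc matrix_inv_left_right[OF det_h[OF x]])
  then have "0 \<le> ?w \<bullet> ?v" using pos_h[OF x, of ?w] by (cases "?w = 0") auto
  then show ?thesis
    by (simp add: inner_vec_def matrix_vector_mult_def cometric_def sum_distrib_left ac_simps)
qed

lemmas smooth_arith = smooth_on_add[OF open_U] smooth_on_mult[OF open_U] smooth_on_diff[OF open_U]
  smooth_on_uminus[OF open_U] smooth_on_sum[OF open_U] smooth_on_const smooth_on_partial

lemma smooth_h_component: "smooth_on U (\<lambda>x. h x $ i $ j)"
  by (intro smooth_on_component open_U smooth_h)

lemma smooth_cometric: "smooth_on U (cometric i j)"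
  using smooth_on_matrix_inv[OF open_U smooth_h_component det_h, of i j]
  by (simp add: cometric_def[abs_def])

lemma christoffel_alt: "Gam l i j x = (\<Sum>m\<in>UNIV. cometric l m x *
     (partial i (\<lambda>y. h y $ j $ m) x + partial j (\<lambda>y. h y $ i $ m) x - partial m (\<lambda>y. h y $ i $ j) x)) * (1/2)"
  by (simp add: christoffel_def cometric_def)

lemma smooth_christoffel: "smooth_on U (Gam l i j)"
proof -
  have "smooth_on U (\<lambda>x. Gam l i j x)"
    unfolding christoffel_alt by (intro smooth_arith smooth_cometric smooth_h_component)
  then show ?thesis by simp
qed

lemmas smooths = smooth_arith smooth_h_component smooth_cometric smooth_christoffel

lemma partial_h_sym: "x \<in> U \<Longrightarrow> partial k (\<lambda>y. h y $ i $ j) x = partial k (\<lambda>y. h y $ j $ i) x"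
  by (rule partial_cong_open[OF open_U]) (auto simp: h_sym)

lemma christoffel_sym: "x \<in> U \<Longrightarrow> Gam l i j x = Gam l j i x"
  unfolding christoffel_def using partial_h_sym[of x _ i j] by (simp add: algebra_simps)

lemma christoffel_lower: "x \<in> U \<Longrightarrow> (\<Sum>l\<in>UNIV. h x $ k $ l * Gam l i j x)
  = (partial i (\<lambda>y. h y $ j $ k) x + partial j (\<lambda>y. h y $ i $ k) x - partial k (\<lambda>y. h y $ i $ j) x) / 2"
proof -
  assume x: "x \<in> U"
  let ?p = "\<lambda>m. partial i (\<lambda>y. h y $ j $ m) x + partial j (\<lambda>y. h y $ i $ m) x - partial m (\<lambda>y. h y $ i $ j) x"
  have "(\<Sum>l\<in>UNIV. h x $ k $ l * Gam l i j x) = (\<Sum>l\<in>UNIV. \<Sum>m\<in>UNIV. h x $ k $ l * cometric l m x * (?p m / 2))"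
    by (simp add: christoffel_alt sum_distrib_left sum_distrib_right sum_divide_distrib mult.assoc)
  also have "\<dots> = (\<Sum>m\<in>UNIV. (\<Sum>l\<in>UNIV. h x $ k $ l * cometric l m x) * (?p m / 2))"
    unfolding sum_distrib_right by (rule sum.swap)
  also have "\<dots> = ?p k / 2" by (simp only: h_cometric[OF x] sum_kronecker)
  finally show ?thesis .
qed

text \<open>The Levi-Civita connection is metric: \<open>\<nabla>h = 0\<close>, written out for the derivatives of \<open>h\<close>.\<close>

lemma metric_compatible: "x \<in> U \<Longrightarrow> partial k (\<lambda>y. h y $ i $ j) x
  = (\<Sum>m\<in>UNIV. Gam m k i x * h x $ m $ j) + (\<Sum>m\<in>UNIV. h x $ i $ m * Gam m k j x)"
proof -
  assume x: "x \<in> U"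
  have "(\<Sum>m\<in>UNIV. Gam m k i x * h x $ m $ j) = (\<Sum>l\<in>UNIV. h x $ j $ l * Gam l k i x)"
    by (rule sum.cong) (auto simp: h_sym[OF x])
  then show ?thesis
    using partial_h_sym[OF x, of k i j] by (simp only: christoffel_lower[OF x]) (simp add: field_simps)
qed

text \<open>This is \<open>\<nabla>h\<^sup>-\<^sup>1 = 0\<close>. It follows from \<open>\<nabla>h = 0\<close> by differentiating \<open>h\<^sup>-\<^sup>1 h = 1\<close>; the computation is
  matrix algebra with \<open>C\<close> the connection matrix in the direction \<open>k\<close>.\<close>

lemma partial_cometric: "x \<in> U \<Longrightarrow> partial k (cometric i j) x
  = - (\<Sum>m\<in>UNIV. Gam i k m x * cometric m j x) - (\<Sum>m\<in>UNIV. Gam j k m x * cometric i m x)"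
proof -
  assume x: "x \<in> U"
  define G where "G = h x"
  define I where "I = matrix_inv (h x)"
  define C where "C = (\<chi> i m. Gam i k m x)"
  define P where "P = (\<chi> i j. partial k (cometric i j) x)"
  define B where "B = (\<chi> i j. partial k (\<lambda>y. h y $ i $ j) x)"
  have GI: "G ** I = mat 1" "I ** G = mat 1"
    using matrix_inv_left_right[OF det_h[OF x]] by (auto simp: G_def I_def)
  have "partial k (\<lambda>y. \<Sum>m\<in>UNIV. cometric i m y * h y $ m $ l) x = 0" for i l
  proof -
    have "partial k (\<lambda>y. \<Sum>m\<in>UNIV. cometric i m y * h y $ m $ l) x = partial k (\<lambda>y. of_bool (l = i)) x"
    proof (rule partial_cong_open[OF open_U x])
      fix y assume y: "y \<in> U"
      have "(\<Sum>m\<in>UNIV. cometric i m y * h y $ m $ l) = (\<Sum>m\<in>UNIV. h y $ l $ m * cometric m i y)"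
        using h_sym[OF y, of _ l] cometric_sym[OF y, of i] by (intro sum.cong refl) (simp only: mult.commute)
      then show "(\<Sum>m\<in>UNIV. cometric i m y * h y $ m $ l) = of_bool (l = i)"
        by (simp only: h_cometric[OF y])
    qed
    then show ?thesis by (simp add: partial_const)
  qed
  then have "(\<Sum>m\<in>UNIV. cometric i m x * partial k (\<lambda>y. h y $ m $ l) x + partial k (cometric i m) x * h x $ m $ l) = 0" for i l
    using x by (simp add: partial_sum[OF open_U] partial_mult[of U] smooths)
  then have "I ** B + P ** G = 0"
    by (simp add: vec_eq_iff matrix_matrix_mult_def I_def B_def P_def G_def cometric_def sum.distrib)
  moreover have "B = transpose C ** G + G ** C"
    using metric_compatible[OF x]
    by (simp add: vec_eq_iff matrix_matrix_mult_def B_def C_def G_def transpose_def)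
  ultimately have "I ** transpose C ** G + C + P ** G = 0"
    by (simp add: matrix_add_ldistrib matrix_mul_assoc GI matrix_mul_lid)
  moreover have "P ** G = (I ** transpose C ** G + C + P ** G) - I ** transpose C ** G - C"
    by simp
  ultimately have "P ** G = - (I ** transpose C ** G) - C"
    by simp
  then have "P ** G ** I = (- (I ** transpose C ** G) - C) ** I" by simp
  also have "P ** G ** I = P"
    by (simp add: matrix_mul_assoc[symmetric] GI matrix_mul_rid)
  also have "(- (I ** transpose C ** G) - C) ** I = - (I ** transpose C) - C ** I"
  proof -
    have "(- (I ** transpose C ** G) - C) ** I = - (I ** transpose C ** G ** I) - C ** I"
      by (simp add: vec_eq_iff matrix_matrix_mult_def left_diff_distrib sum_subtractf sum_negf)
    then show ?thesis by (simp add: matrix_mul_assoc[symmetric] GI matrix_mul_rid)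
  qed
  finally have "P $ i $ j = (- (I ** transpose C) - C ** I) $ i $ j" by simp
  then show ?thesis
    by (simp add: P_def matrix_matrix_mult_def C_def I_def transpose_def cometric_def mult.commute)
qed

text \<open>The components of \<open>\<nabla>\<^sub>p V\<close> for the vector field with components \<open>V l\<close>. A tensor with further indices
  is also fed to this operator, with all but one upper index frozen as parameters; the Christoffel terms
  of the frozen indices then have to be added separately.\<close>

definition covd :: "'n \<Rightarrow> ('n \<Rightarrow> real^'n \<Rightarrow> real) \<Rightarrow> 'n \<Rightarrow> real^'n \<Rightarrow> real" where
  "covd p V l x = partial p (V l) x + (\<Sum>m\<in>UNIV. Gam l p m x * V m x)"

lemma smooth_covd: "(\<And>l. smooth_on U (V l)) \<Longrightarrow> smooth_on U (covd p V l)"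
  unfolding covd_def[abs_def] by (intro smooths)

lemma covd_cong: "x \<in> U \<Longrightarrow> (\<And>l y. y \<in> U \<Longrightarrow> V l y = W l y) \<Longrightarrow> covd p V l x = covd p W l x"
  unfolding covd_def using partial_cong_open[OF open_U, of x "V l" "W l"] by simp

lemma covd_diff:
  assumes "\<And>l. smooth_on U (V l)" "\<And>l. smooth_on U (W l)" "x \<in> U"
  shows "covd p (\<lambda>l x. V l x - W l x) l x = covd p V l x - covd p W l x"
  using assms by (simp add: covd_def partial_diff[OF open_U] sum_subtractf right_diff_distrib)

text \<open>The Leibniz rule for a linear combination of vector fields with functions as coefficients.\<close>

lemma covd_comb:
  assumes "\<And>n. smooth_on U (a n)" "\<And>n l. smooth_on U (V n l)" "x \<in> U"
  shows "covd p (\<lambda>l x. \<Sum>n\<in>UNIV. a n x * V n l x) l x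
    = (\<Sum>n\<in>UNIV. partial p (a n) x * V n l x + a n x * covd p (V n) l x)"
proof -
  have "(\<Sum>m\<in>UNIV. Gam l p m x * (\<Sum>n\<in>UNIV. a n x * V n m x))
      = (\<Sum>m\<in>UNIV. \<Sum>n\<in>UNIV. a n x * (Gam l p m x * V n m x))"
    by (simp add: sum_distrib_left ac_simps)
  also have "\<dots> = (\<Sum>n\<in>UNIV. a n x * (\<Sum>m\<in>UNIV. Gam l p m x * V n m x))"
    by (subst sum.swap) (simp add: sum_distrib_left)
  finally show ?thesis
    using assms by (simp add: covd_def partial_sum[OF open_U] partial_mult[of U] smooths
        sum.distrib[symmetric] algebra_simps)
qed

lemma covd_covd:
  assumes V: "\<And>l. smooth_on U (V l)" and x: "x \<in> U"
  shows "covd p (covd q V) l x = partial p (partial q (V l)) x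
    + (\<Sum>k\<in>UNIV. Gam l q k x * partial p (V k) x) + (\<Sum>k\<in>UNIV. Gam l p k x * partial q (V k) x)
    + (\<Sum>k\<in>UNIV. (partial p (Gam l q k) x + (\<Sum>m\<in>UNIV. Gam l p m x * Gam m q k x)) * V k x)"
proof -
  have "(\<Sum>m\<in>UNIV. Gam l p m x * (\<Sum>k\<in>UNIV. Gam m q k x * V k x))
      = (\<Sum>m\<in>UNIV. \<Sum>k\<in>UNIV. Gam l p m x * Gam m q k x * V k x)"
    by (simp add: sum_distrib_left ac_simps)
  also have "\<dots> = (\<Sum>k\<in>UNIV. (\<Sum>m\<in>UNIV. Gam l p m x * Gam m q k x) * V k x)"
    by (subst sum.swap) (simp add: sum_distrib_right)
  finally have 1: "(\<Sum>m\<in>UNIV. Gam l p m x * (\<Sum>k\<in>UNIV. Gam m q k x * V k x)) = \<dots>" .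
  have 2: "partial p (covd q V l) x = partial p (partial q (V l)) x
      + (\<Sum>k\<in>UNIV. Gam l q k x * partial p (V k) x + partial p (Gam l q k) x * V k x)"
    unfolding covd_def[abs_def] using V x
    by (simp add: partial_add[of U] partial_sum[OF open_U] partial_mult[of U] smooths)
  show ?thesis
    unfolding covd_def[of p "covd q V"] 2 unfolding covd_def[of q V]
    by (simp add: 1 sum.distrib distrib_left distrib_right)
qed

definition curv :: "'n \<Rightarrow> 'n \<Rightarrow> ('n \<Rightarrow> real^'n \<Rightarrow> real) \<Rightarrow> 'n \<Rightarrow> real^'n \<Rightarrow> real" where
  "curv p q V l x = (\<Sum>k\<in>UNIV. riemann h l p q k x * V k x)"

text \<open>The components \<open>riemann\<close> are those of the commutator of \<open>\<nabla>\<^sub>p\<close> and \<open>\<nabla>\<^sub>q\<close>; the second partial derivatives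
  cancel, and the first order terms of \<open>covd_covd\<close> are symmetric in \<open>p\<close> and \<open>q\<close>.\<close>

lemma ricci_identity:
  assumes V: "\<And>l. smooth_on U (V l)" and x: "x \<in> U"
  shows "curv p q V l x = covd p (covd q V) l x - covd q (covd p V) l x"
  using partial_commute[OF open_U x V, of p q l]
  by (simp add: covd_covd[OF V x] curv_def riemann_def sum_subtractf left_diff_distrib
      distrib_right sum.distrib)

lemma smooth_riemann: "smooth_on U (riemann h l i j k)"
  unfolding riemann_def[abs_def] by (intro smooths)

text \<open>Column \<open>k\<close> of the inverse metric is the gradient of the \<open>k\<close>-th coordinate function. These vector
  fields serve as a frame whose covariant derivatives are known.\<close>

lemma covd_cometric: "x \<in> U \<Longrightarrow> covd p (\<lambda>l. cometric l k) l x = - (\<Sum>n\<in>UNIV. Gam k p n x * cometric l n x)"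
  by (simp add: covd_def partial_cometric)

text \<open>The curvature \<open>R(\<partial>\<^sub>p, \<partial>\<^sub>q)\<close> as a bivector, that is, with its last lower index raised to \<open>k\<close>. In this form
  both antisymmetries concern indices of the same kind, and double traces need no metric.\<close>

definition curv_raised :: "'n \<Rightarrow> 'n \<Rightarrow> 'n \<Rightarrow> 'n \<Rightarrow> real^'n \<Rightarrow> real" where
  "curv_raised p q l k = curv p q (\<lambda>l. cometric l k) l"

lemma smooth_curv_raised: "smooth_on U (curv_raised p q l k)"
proof -
  have "smooth_on U (\<lambda>x. curv_raised p q l k x)"
    unfolding curv_raised_def curv_def by (intro smooths smooth_riemann)
  then show ?thesis by simp
qed

lemma riemann_antisym: "riemann h l q p k x = - riemann h l p q k x"
  by (simp add: riemann_def sum_subtractf)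

lemma curv_raised_antisym_lower: "curv_raised q p l k x = - curv_raised p q l k x"
  by (simp add: curv_raised_def curv_def riemann_antisym[of _ q p] sum_negf)

lemma covd_covd_cometric:
  assumes x: "x \<in> U"
  shows "covd p (covd q (\<lambda>l. cometric l k)) l x
    = - (\<Sum>n\<in>UNIV. (partial p (Gam k q n) x - (\<Sum>m\<in>UNIV. Gam k q m x * Gam m p n x)) * cometric l n x)"
proof -
  have "covd p (covd q (\<lambda>l. cometric l k)) l x = covd p (\<lambda>l x. \<Sum>n\<in>UNIV. - Gam k q n x * cometric l n x) l x"
    by (rule covd_cong[OF x]) (simp add: covd_cometric sum_negf)
  also have "\<dots> = (\<Sum>n\<in>UNIV. - (partial p (Gam k q n) x * cometric l n x)
      + Gam k q n x * (\<Sum>m\<in>UNIV. Gam n p m x * cometric l m x))"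
    using x by (subst covd_comb) (auto intro!: smooths simp: partial_uminus[of U] smooths covd_cometric)
  also have "\<dots> = - (\<Sum>n\<in>UNIV. partial p (Gam k q n) x * cometric l n x)
      + (\<Sum>n\<in>UNIV. \<Sum>m\<in>UNIV. Gam k q n x * Gam n p m x * cometric l m x)"
    by (simp add: sum.distrib sum_negf sum_subtractf sum_distrib_left ac_simps)
  also have "(\<Sum>n\<in>UNIV. \<Sum>m\<in>UNIV. Gam k q n x * Gam n p m x * cometric l m x)
     = (\<Sum>n\<in>UNIV. (\<Sum>m\<in>UNIV. Gam k q m x * Gam m p n x) * cometric l n x)"
    by (subst sum.swap) (simp add: sum_distrib_right)
  finally show ?thesis by (simp add: left_diff_distrib sum_subtractf)
qed

text \<open>Two covariant derivatives of the gradient of a coordinate function have, by \<open>covd_cometric\<close>, the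
  Christoffel symbols with upper index \<open>k\<close> as coefficients. Antisymmetrizing in \<open>p\<close> and \<open>q\<close>, these combine
  to the curvature components with upper index \<open>k\<close>, with the opposite sign.\<close>

lemma curv_raised_antisym_upper:
  assumes x: "x \<in> U"
  shows "curv_raised p q l k x = - curv_raised p q k l x"
proof -
  have "curv_raised p q l k x = - (\<Sum>n\<in>UNIV. riemann h k p q n x * cometric l n x)"
    unfolding curv_raised_def ricci_identity[OF smooth_cometric x] covd_covd_cometric[OF x]
    by (simp add: riemann_def left_diff_distrib distrib_right sum_subtractf sum.distrib)
  then show ?thesis by (simp add: curv_raised_def curv_def cometric_sym[OF x, of l])
qed

text \<open>This covariant derivative in the direction \<open>p\<close> treats only the two upper indices as tensor indices.
  The corrections for \<open>q\<close> and \<open>r\<close> would cancel in every cyclic sum, as the connection is torsion free.\<close>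

definition dcurv_raised :: "'n \<Rightarrow> 'n \<Rightarrow> 'n \<Rightarrow> 'n \<Rightarrow> 'n \<Rightarrow> real^'n \<Rightarrow> real" where
  "dcurv_raised p q r l k x = partial p (curv_raised q r l k) x
     + (\<Sum>m\<in>UNIV. Gam l p m x * curv_raised q r m k x) + (\<Sum>m\<in>UNIV. Gam k p m x * curv_raised q r l m x)"

text \<open>The derivative is the commutator \<open>[\<nabla>\<^sub>p, [\<nabla>\<^sub>q, \<nabla>\<^sub>r]]\<close> evaluated on the gradient of the \<open>k\<close>-th coordinate
  function: the Christoffel terms for the upper index \<open>k\<close> come from differentiating that gradient.\<close>

lemma dcurv_raised_eq:
  assumes x: "x \<in> U"
  defines "V \<equiv> \<lambda>k l. cometric l k"
  shows "dcurv_raised p q r l k x = covd p (covd q (covd r (V k))) l x - covd p (covd r (covd q (V k))) l x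
    - (covd q (covd r (covd p (V k))) l x - covd r (covd q (covd p (V k))) l x)"
proof -
  have sm: "smooth_on U (V k l)" for k l by (simp add: V_def smooth_cometric)
  have "covd p (\<lambda>l. curv_raised q r l k) l x
      = covd p (\<lambda>l x. covd q (covd r (V k)) l x - covd r (covd q (V k)) l x) l x"
    by (rule covd_cong[OF x]) (use ricci_identity[OF sm] in \<open>simp add: curv_raised_def V_def\<close>)
  also have "\<dots> = covd p (covd q (covd r (V k))) l x - covd p (covd r (covd q (V k))) l x"
    by (intro covd_diff smooth_covd sm x)
  finally have 1: "covd p (\<lambda>l. curv_raised q r l k) l x = \<dots>" .
  have "covd q (covd r (covd p (V k))) l x - covd r (covd q (covd p (V k))) l x
      = curv q r (covd p (V k)) l x"
    by (rule ricci_identity[symmetric]) (intro smooth_covd sm x)+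
  also have "\<dots> = - (\<Sum>m\<in>UNIV. \<Sum>n\<in>UNIV. riemann h l q r m x * (Gam k p n x * cometric m n x))"
    by (simp add: curv_def V_def covd_cometric[OF x] sum_negf sum_distrib_left)
  also have "\<dots> = - (\<Sum>n\<in>UNIV. Gam k p n x * curv_raised q r l n x)"
    by (subst sum.swap) (simp add: curv_raised_def curv_def sum_distrib_left ac_simps)
  finally show ?thesis using 1 by (simp add: dcurv_raised_def covd_def)
qed

text \<open>The Jacobi identity for \<open>\<nabla>\<^sub>p\<close>, \<open>\<nabla>\<^sub>q\<close> and \<open>\<nabla>\<^sub>r\<close>.\<close>

lemma second_bianchi:
  assumes x: "x \<in> U"
  shows "dcurv_raised p q r l k x + dcurv_raised q r p l k x + dcurv_raised r p q l k x = 0"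
  by (simp add: dcurv_raised_eq[OF x])

lemma dcurv_raised_antisym:
  assumes x: "x \<in> U"
  shows "dcurv_raised p q r l k x = dcurv_raised p r q k l x"
proof -
  have e: "curv_raised q r l k y = curv_raised r q k l y" if "y \<in> U" for y l k
    using curv_raised_antisym_upper[OF that, of q r l k] curv_raised_antisym_lower[of q r k l y] by simp
  have "partial p (curv_raised q r l k) x = partial p (curv_raised r q k l) x"
    by (rule partial_cong_open[OF open_U x]) (rule e)
  then show ?thesis by (simp add: dcurv_raised_def e[OF x])
qed

text \<open>The Ricci tensor with its second index raised (see \<open>ricmix_eq\<close>). It is defined as a contraction of
  the raised curvature so that the Bianchi identity can be traced without derivatives of the metric.\<close>

definition ricmix :: "'n \<Rightarrow> 'n \<Rightarrow> real^'n \<Rightarrow> real" where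
  "ricmix i m x = (\<Sum>j\<in>UNIV. curv_raised i j m j x)"

lemma smooth_ricmix: "smooth_on U (ricmix i m)"
  unfolding ricmix_def[abs_def] by (intro smooths smooth_curv_raised)

text \<open>The divergence of a tensor \<open>T p i\<close> with lower index \<open>p\<close> and upper index \<open>i\<close>. The first sum handles the
  upper index only, the second sum is the Christoffel correction for \<open>p\<close>.\<close>

definition div_mix :: "('n \<Rightarrow> 'n \<Rightarrow> real^'n \<Rightarrow> real) \<Rightarrow> 'n \<Rightarrow> real^'n \<Rightarrow> real" where
  "div_mix T p x = (\<Sum>i\<in>UNIV. covd i (T p) i x) - (\<Sum>i\<in>UNIV. \<Sum>m\<in>UNIV. Gam i p m x * T i m x)"

text \<open>Contract the second Bianchi identity by setting \<open>(q, r) = (i, j) = (l, k)\<close> and summing. The first term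
  of the cyclic sum becomes the derivative of the scalar curvature up to Christoffel terms. The other two
  agree by the antisymmetries, and each is minus the divergence of the Ricci tensor up to Christoffel
  terms. The symmetry of the Christoffel symbols removes the leftover contraction with the curvature.\<close>

lemma contracted_bianchi:
  assumes x: "x \<in> U"
  shows "partial p (\<lambda>y. \<Sum>i\<in>UNIV. ricmix i i y) x = 2 * div_mix ricmix p x"
proof -
  have "0 = (\<Sum>i\<in>UNIV. \<Sum>j\<in>UNIV. dcurv_raised p i j i j x + dcurv_raised i j p i j x + dcurv_raised j p i i j x)"
    by (simp add: second_bianchi[OF x])
  also have "\<dots> = (\<Sum>i\<in>UNIV. \<Sum>j\<in>UNIV. dcurv_raised p i j i j x) + (\<Sum>i\<in>UNIV. \<Sum>j\<in>UNIV. dcurv_raised i j p i j x)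
      + (\<Sum>i\<in>UNIV. \<Sum>j\<in>UNIV. dcurv_raised j p i i j x)"
    by (simp add: sum.distrib)
  also have "(\<Sum>i\<in>UNIV. \<Sum>j\<in>UNIV. dcurv_raised j p i i j x) = (\<Sum>j\<in>UNIV. \<Sum>i\<in>UNIV. dcurv_raised j i p j i x)"
    by (subst sum.swap) (simp add: dcurv_raised_antisym[OF x, of _ p])
  also have "(\<Sum>i\<in>UNIV. \<Sum>j\<in>UNIV. dcurv_raised p i j i j x)
      = partial p (\<lambda>y. \<Sum>i\<in>UNIV. ricmix i i y) x + 2 * (\<Sum>i\<in>UNIV. \<Sum>m\<in>UNIV. Gam i p m x * ricmix i m x)"
  proof -
    have "partial p (\<lambda>y. \<Sum>i\<in>UNIV. ricmix i i y) x = (\<Sum>i\<in>UNIV. \<Sum>j\<in>UNIV. partial p (curv_raised i j i j) x)"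
      unfolding ricmix_def using x by (simp add: partial_sum[OF open_U] smooths smooth_curv_raised)
    moreover have A: "(\<Sum>i\<in>UNIV. \<Sum>j\<in>UNIV. \<Sum>m\<in>UNIV. Gam i p m x * curv_raised i j m j x)
        = (\<Sum>i\<in>UNIV. \<Sum>m\<in>UNIV. Gam i p m x * ricmix i m x)"
      unfolding ricmix_def sum_distrib_left by (intro sum.cong refl sum.swap)
    moreover have "(\<Sum>i\<in>UNIV. \<Sum>j\<in>UNIV. \<Sum>m\<in>UNIV. Gam j p m x * curv_raised i j i m x)
        = (\<Sum>i\<in>UNIV. \<Sum>j\<in>UNIV. \<Sum>m\<in>UNIV. Gam i p m x * curv_raised i j m j x)"
    proof -
      have e: "curv_raised i j i m x = curv_raised j i m i x" for i j m
        using curv_raised_antisym_upper[OF x, of i j i m] curv_raised_antisym_lower[of i j m i x] by simp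
      have "(\<Sum>i\<in>UNIV. \<Sum>j\<in>UNIV. \<Sum>m\<in>UNIV. Gam j p m x * curv_raised i j i m x)
          = (\<Sum>i\<in>UNIV. \<Sum>j\<in>UNIV. \<Sum>m\<in>UNIV. Gam j p m x * curv_raised j i m i x)"
        by (intro sum.cong refl arg_cong2[of _ _ _ _ "(*)"] e)
      also have "\<dots> = (\<Sum>i\<in>UNIV. \<Sum>j\<in>UNIV. \<Sum>m\<in>UNIV. Gam i p m x * curv_raised i j m j x)"
        by (rule sum.swap)
      finally show ?thesis .
    qed
    ultimately show ?thesis by (simp add: dcurv_raised_def sum.distrib)
  qed
  also have "(\<Sum>j\<in>UNIV. \<Sum>i\<in>UNIV. dcurv_raised j i p j i x) = - (\<Sum>i\<in>UNIV. covd i (ricmix p) i x)"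
  proof -
    have "dcurv_raised i j p i j x = - (partial i (curv_raised p j i j) x + (\<Sum>m\<in>UNIV. Gam i i m x * curv_raised p j m j x)
        + (\<Sum>m\<in>UNIV. Gam j i m x * curv_raised p j i m x))" for i j
    proof -
      have "partial i (curv_raised j p i j) x = partial i (\<lambda>y. - curv_raised p j i j y) x"
        by (rule partial_cong_open[OF open_U x]) (rule curv_raised_antisym_lower)
      also have "\<dots> = - partial i (curv_raised p j i j) x" by (rule partial_uminus[OF smooth_curv_raised x])
      finally show ?thesis by (simp add: dcurv_raised_def curv_raised_antisym_lower[of j p] sum_negf)
    qed
    moreover have "(\<Sum>i\<in>UNIV. \<Sum>j\<in>UNIV. \<Sum>m\<in>UNIV. Gam j i m x * curv_raised p j i m x) = 0"
    proof -
      have "(\<Sum>i\<in>UNIV. \<Sum>m\<in>UNIV. Gam j i m x * curv_raised p j i m x) = 0" for j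
      proof -
        have "(\<Sum>i\<in>UNIV. \<Sum>m\<in>UNIV. Gam j i m x * curv_raised p j i m x)
            = (\<Sum>i\<in>UNIV. \<Sum>m\<in>UNIV. Gam j m i x * curv_raised p j m i x)"
          by (rule sum.swap)
        also have "\<dots> = (\<Sum>i\<in>UNIV. \<Sum>m\<in>UNIV. - (Gam j i m x * curv_raised p j i m x))"
          using christoffel_sym[OF x] curv_raised_antisym_upper[OF x] by (intro sum.cong refl) (metis mult_minus_right)
        finally show ?thesis by (simp add: sum_negf)
      qed
      then show ?thesis by (subst sum.swap) simp
    qed
    moreover have "covd i (ricmix p) i x = (\<Sum>j\<in>UNIV. partial i (curv_raised p j i j) x)
        + (\<Sum>j\<in>UNIV. \<Sum>m\<in>UNIV. Gam i i m x * curv_raised p j m j x)" for i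
    proof -
      have "partial i (ricmix p i) x = (\<Sum>j\<in>UNIV. partial i (curv_raised p j i j) x)"
        unfolding ricmix_def[abs_def] using x by (simp add: partial_sum[OF open_U] smooth_curv_raised)
      moreover have "(\<Sum>m\<in>UNIV. Gam i i m x * ricmix p m x) = (\<Sum>j\<in>UNIV. \<Sum>m\<in>UNIV. Gam i i m x * curv_raised p j m j x)"
        unfolding ricmix_def sum_distrib_left by (rule sum.swap)
      ultimately show ?thesis by (simp add: covd_def)
    qed
    ultimately show ?thesis by (simp add: sum_negf sum_subtractf sum.distrib)
  qed
  finally show ?thesis by (simp add: div_mix_def)
qed

lemma ricmix_eq: "x \<in> U \<Longrightarrow> ricmix i m x = (\<Sum>k\<in>UNIV. ricci h x $ i $ k * cometric k m x)"
proof -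
  assume x: "x \<in> U"
  have "curv_raised i j m j x = curv_raised j i j m x" for j
    using curv_raised_antisym_upper[OF x, of i j m j] curv_raised_antisym_lower[of i j j m x] by simp
  then have "ricmix i m x = (\<Sum>j\<in>UNIV. \<Sum>k\<in>UNIV. riemann h j j i k x * cometric k m x)"
    by (simp add: ricmix_def curv_raised_def curv_def)
  also have "\<dots> = (\<Sum>k\<in>UNIV. ricci h x $ i $ k * cometric k m x)"
    by (subst sum.swap) (simp add: ricci_def sum_distrib_right)
  finally show ?thesis .
qed

end

section \<open>Gradients and the Bochner formula\<close>

context metric_chart begin

text \<open>The gradient as a family of component functions, the form that \<open>covd\<close> differentiates.\<close>

definition gradc :: "(real^'n \<Rightarrow> real) \<Rightarrow> 'n \<Rightarrow> real^'n \<Rightarrow> real" where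
  "gradc F i x = (\<Sum>j\<in>UNIV. partial j F x * cometric i j x)"

text \<open>The Hessian with its second index raised. It is the covariant derivative of the gradient
  (see \<open>covd_gradc\<close>), its trace is the Laplacian, and the trace of its square is \<open>\<bar>Hess F\<bar>\<^sup>2\<close>.\<close>

definition hessmix :: "(real^'n \<Rightarrow> real) \<Rightarrow> 'n \<Rightarrow> 'n \<Rightarrow> real^'n \<Rightarrow> real" where
  "hessmix F p i x = (\<Sum>k\<in>UNIV. cometric i k x * hess h F x $ p $ k)"

definition normsq :: "(real^'n \<Rightarrow> real) \<Rightarrow> real^'n \<Rightarrow> real" where
  "normsq F x = (\<Sum>k\<in>UNIV. gradc F k x * partial k F x)"

definition divg :: "('n \<Rightarrow> real^'n \<Rightarrow> real) \<Rightarrow> real^'n \<Rightarrow> real" where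
  "divg V x = (\<Sum>i\<in>UNIV. covd i V i x)"

lemma smooth_gradc: "smooth_on U F \<Longrightarrow> smooth_on U (gradc F i)"
  unfolding gradc_def[abs_def] by (intro smooths)

lemma smooth_hess: "smooth_on U F \<Longrightarrow> smooth_on U (\<lambda>x. hess h F x $ i $ j)"
  unfolding hess_def by simp (intro smooths)

lemma smooth_hessmix: "smooth_on U F \<Longrightarrow> smooth_on U (hessmix F p i)"
  unfolding hessmix_def[abs_def] by (intro smooths smooth_hess)

lemma smooth_normsq: "smooth_on U F \<Longrightarrow> smooth_on U (normsq F)"
  unfolding normsq_def[abs_def] by (intro smooths smooth_gradc)

lemma hess_sym: "smooth_on U F \<Longrightarrow> x \<in> U \<Longrightarrow> hess h F x $ i $ j = hess h F x $ j $ i"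
  using partial_commute[OF open_U, of x F i j] by (simp add: hess_def christoffel_sym[of x _ i j])

lemma covd_gradc:
  assumes F: "smooth_on U F" and x: "x \<in> U"
  shows "covd p (gradc F) l x = hessmix F p l x"
proof -
  have "covd p (gradc F) l x = (\<Sum>n\<in>UNIV. partial p (partial n F) x * cometric l n x
      - partial n F x * (\<Sum>k\<in>UNIV. Gam n p k x * cometric l k x))"
    unfolding gradc_def[abs_def] using F x by (subst covd_comb) (auto simp: smooths covd_cometric)
  also have "\<dots> = (\<Sum>n\<in>UNIV. partial p (partial n F) x * cometric l n x)
      - (\<Sum>n\<in>UNIV. \<Sum>k\<in>UNIV. partial n F x * Gam n p k x * cometric l k x)"
    by (simp add: sum_subtractf sum_distrib_left ac_simps)
  also have "(\<Sum>n\<in>UNIV. \<Sum>k\<in>UNIV. partial n F x * Gam n p k x * cometric l k x)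
      = (\<Sum>k\<in>UNIV. \<Sum>n\<in>UNIV. partial n F x * Gam n p k x * cometric l k x)"
    by (rule sum.swap)
  finally show ?thesis
    by (simp add: hessmix_def hess_def right_diff_distrib sum_subtractf sum_distrib_left ac_simps)
qed

lemma partial_gradc:
  assumes F: "smooth_on U F" and x: "x \<in> U"
  shows "partial p (gradc F l) x = hessmix F p l x - (\<Sum>m\<in>UNIV. Gam l p m x * gradc F m x)"
  using covd_gradc[OF assms, of p l] by (simp add: covd_def)

lemma raised_hess_sym:
  assumes F: "smooth_on U F" and x: "x \<in> U"
  shows "(\<Sum>p\<in>UNIV. cometric i p x * hessmix F p k x) = (\<Sum>p\<in>UNIV. cometric k p x * hessmix F p i x)"
proof -
  have "(\<Sum>p\<in>UNIV. cometric i p x * hessmix F p k x)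
     = (\<Sum>p\<in>UNIV. \<Sum>q\<in>UNIV. cometric i p x * cometric k q x * hess h F x $ p $ q)"
    by (simp add: hessmix_def sum_distrib_left ac_simps)
  also have "\<dots> = (\<Sum>q\<in>UNIV. \<Sum>p\<in>UNIV. cometric i p x * cometric k q x * hess h F x $ p $ q)"
    by (rule sum.swap)
  also have "\<dots> = (\<Sum>q\<in>UNIV. \<Sum>p\<in>UNIV. cometric i p x * cometric k q x * hess h F x $ q $ p)"
    by (intro sum.cong refl arg_cong2[of _ _ _ _ "(*)"] hess_sym F x)
  finally show ?thesis by (simp add: hessmix_def sum_distrib_left ac_simps)
qed

text \<open>The metric is parallel, so \<open>d\<bar>\<nabla>F\<bar>\<^sup>2 = 2 Hess F(\<nabla>F, \<cdot>)\<close>: the Christoffel terms of the two factors cancel.\<close>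

lemma partial_normsq:
  assumes F: "smooth_on U F" and x: "x \<in> U"
  shows "partial p (normsq F) x = 2 * (\<Sum>k\<in>UNIV. hessmix F p k x * partial k F x)"
proof -
  have "partial p (normsq F) x
     = (\<Sum>k\<in>UNIV. gradc F k x * partial p (partial k F) x + partial p (gradc F k) x * partial k F x)"
    unfolding normsq_def[abs_def] using F x
    by (simp add: partial_sum[OF open_U] partial_mult[of U] smooths smooth_gradc)
  also have "\<dots> = (\<Sum>k\<in>UNIV. gradc F k x * hess h F x $ p $ k) + (\<Sum>k\<in>UNIV. hessmix F p k x * partial k F x)
     + ((\<Sum>k\<in>UNIV. \<Sum>m\<in>UNIV. gradc F k x * (Gam m p k x * partial m F x))
       - (\<Sum>k\<in>UNIV. \<Sum>m\<in>UNIV. gradc F m x * (Gam k p m x * partial k F x)))"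
    by (simp add: partial_gradc[OF F x] hess_def algebra_simps sum.distrib sum_subtractf sum_distrib_left)
  also have "(\<Sum>k\<in>UNIV. \<Sum>m\<in>UNIV. gradc F k x * (Gam m p k x * partial m F x))
     = (\<Sum>k\<in>UNIV. \<Sum>m\<in>UNIV. gradc F m x * (Gam k p m x * partial k F x))"
    by (rule sum.swap)
  also have "(\<Sum>k\<in>UNIV. gradc F k x * hess h F x $ p $ k) = (\<Sum>k\<in>UNIV. hessmix F p k x * partial k F x)"
  proof -
    have "(\<Sum>k\<in>UNIV. gradc F k x * hess h F x $ p $ k)
       = (\<Sum>k\<in>UNIV. \<Sum>j\<in>UNIV. cometric j k x * hess h F x $ p $ k * partial j F x)"
      using cometric_sym[OF x] by (simp add: gradc_def sum_distrib_left sum_distrib_right ac_simps)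
    also have "\<dots> = (\<Sum>j\<in>UNIV. hessmix F p j x * partial j F x)"
      by (subst sum.swap) (simp add: hessmix_def sum_distrib_right)
    finally show ?thesis .
  qed
  finally show ?thesis by simp
qed

lemma gradc_normsq:
  assumes F: "smooth_on U F" and x: "x \<in> U"
  shows "gradc (normsq F) i x = 2 * (\<Sum>k\<in>UNIV. gradc F k x * hessmix F k i x)"
proof -
  have "gradc (normsq F) i x = (\<Sum>p\<in>UNIV. \<Sum>k\<in>UNIV. 2 * (cometric i p x * hessmix F p k x * partial k F x))"
    by (simp add: gradc_def partial_normsq[OF F x] sum_distrib_left sum_distrib_right ac_simps)
  also have "\<dots> = (\<Sum>k\<in>UNIV. 2 * ((\<Sum>p\<in>UNIV. cometric i p x * hessmix F p k x) * partial k F x))"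
    by (subst sum.swap) (simp add: sum_distrib_left sum_distrib_right)
  also have "\<dots> = (\<Sum>k\<in>UNIV. 2 * ((\<Sum>p\<in>UNIV. cometric k p x * hessmix F p i x) * partial k F x))"
    by (rule sum.cong[OF refl]) (subst raised_hess_sym[OF F x], rule refl)
  also have "\<dots> = (\<Sum>k\<in>UNIV. \<Sum>p\<in>UNIV. 2 * (cometric p k x * hessmix F p i x * partial k F x))"
    by (simp add: cometric_sym[OF x] sum_distrib_left sum_distrib_right)
  also have "\<dots> = 2 * (\<Sum>k\<in>UNIV. gradc F k x * hessmix F k i x)"
    by (subst sum.swap) (simp add: gradc_def sum_distrib_left sum_distrib_right ac_simps)
  finally show ?thesis .
qed

lemma covd_mult:
  assumes a: "smooth_on U a" and V: "\<And>l. smooth_on U (V l)" and x: "x \<in> U"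
  shows "covd p (\<lambda>l x. a x * V l x) l x = partial p a x * V l x + a x * covd p V l x"
  using assms by (simp add: covd_def partial_mult[of U] sum_distrib_left algebra_simps)

lemma divg_mult:
  assumes a: "smooth_on U a" and V: "\<And>l. smooth_on U (V l)" and x: "x \<in> U"
  shows "divg (\<lambda>l x. a x * V l x) x = (\<Sum>i\<in>UNIV. partial i a x * V i x) + a x * divg V x"
  using assms by (simp add: divg_def covd_mult sum.distrib sum_distrib_left)

lemma divg_gradc:
  assumes F: "smooth_on U F" and x: "x \<in> U"
  shows "divg (gradc F) x = (\<Sum>i\<in>UNIV. hessmix F i i x)"
  using assms by (simp add: divg_def covd_gradc)

text \<open>The divergence of \<open>2 Hess F(\<nabla>F, \<cdot>)\<close>: differentiating the Hessian gives its divergence, and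
  differentiating the gradient gives the square of the Hessian.\<close>

lemma divg_gradc_normsq:
  assumes F: "smooth_on U F" and x: "x \<in> U"
  shows "divg (gradc (normsq F)) x
    = 2 * ((\<Sum>k\<in>UNIV. gradc F k x * div_mix (hessmix F) k x) + (\<Sum>i\<in>UNIV. \<Sum>k\<in>UNIV. hessmix F i k x * hessmix F k i x))"
proof -
  have "divg (gradc (normsq F)) x = divg (\<lambda>l y. \<Sum>k\<in>UNIV. (2 * gradc F k y) * hessmix F k l y) x"
    unfolding divg_def by (intro sum.cong refl covd_cong[OF x]) (simp add: gradc_normsq[OF F] sum_distrib_left mult.assoc)
  also have "\<dots> = (\<Sum>i\<in>UNIV. \<Sum>k\<in>UNIV. 2 * (partial i (gradc F k) x * hessmix F k i x)
      + 2 * (gradc F k x * covd i (hessmix F k) i x))"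
    unfolding divg_def using F x
    by (subst covd_comb) (auto simp: smooths smooth_gradc smooth_hessmix partial_mult[of U] partial_const mult.assoc)
  also have "\<dots> = 2 * ((\<Sum>i\<in>UNIV. \<Sum>k\<in>UNIV. hessmix F i k x * hessmix F k i x)
      + (\<Sum>i\<in>UNIV. \<Sum>k\<in>UNIV. gradc F k x * covd i (hessmix F k) i x)
      - (\<Sum>i\<in>UNIV. \<Sum>k\<in>UNIV. (\<Sum>m\<in>UNIV. Gam k i m x * gradc F m x) * hessmix F k i x))"
    by (simp add: partial_gradc[OF F x] left_diff_distrib sum_subtractf sum.distrib sum_distrib_left[symmetric]
       right_diff_distrib)
  also have "(\<Sum>i\<in>UNIV. \<Sum>k\<in>UNIV. gradc F k x * covd i (hessmix F k) i x)
      = (\<Sum>k\<in>UNIV. gradc F k x * (\<Sum>i\<in>UNIV. covd i (hessmix F k) i x))"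
    by (subst sum.swap) (simp add: sum_distrib_left)
  also have "(\<Sum>i\<in>UNIV. \<Sum>k\<in>UNIV. (\<Sum>m\<in>UNIV. Gam k i m x * gradc F m x) * hessmix F k i x)
      = (\<Sum>m\<in>UNIV. gradc F m x * (\<Sum>k\<in>UNIV. \<Sum>i\<in>UNIV. Gam k m i x * hessmix F k i x))"
  proof -
    have "(\<Sum>i\<in>UNIV. \<Sum>k\<in>UNIV. (\<Sum>m\<in>UNIV. Gam k i m x * gradc F m x) * hessmix F k i x)
      = (\<Sum>k\<in>UNIV. \<Sum>i\<in>UNIV. \<Sum>m\<in>UNIV. gradc F m x * (Gam k m i x * hessmix F k i x))"
      by (subst sum.swap) (simp add: sum_distrib_left sum_distrib_right christoffel_sym[OF x] ac_simps)
    also have "\<dots> = (\<Sum>k\<in>UNIV. \<Sum>m\<in>UNIV. \<Sum>i\<in>UNIV. gradc F m x * (Gam k m i x * hessmix F k i x))"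
      by (intro sum.cong refl sum.swap)
    also have "\<dots> = (\<Sum>m\<in>UNIV. \<Sum>k\<in>UNIV. \<Sum>i\<in>UNIV. gradc F m x * (Gam k m i x * hessmix F k i x))"
      by (rule sum.swap)
    finally show ?thesis by (simp add: sum_distrib_left)
  qed
  finally show ?thesis by (simp add: div_mix_def right_diff_distrib sum_subtractf)
qed

text \<open>Trace of the Ricci identity for the gradient, \<open>Ric(\<nabla>F) = div Hess F - d(\<Delta>F)\<close>.\<close>

lemma div_hessmix_commute:
  assumes F: "smooth_on U F" and x: "x \<in> U"
  shows "(\<Sum>k\<in>UNIV. ricci h x $ q $ k * gradc F k x)
    = div_mix (hessmix F) q x - partial q (\<lambda>y. \<Sum>i\<in>UNIV. hessmix F i i y) x"
proof -
  have "(\<Sum>k\<in>UNIV. ricci h x $ q $ k * gradc F k x) = (\<Sum>i\<in>UNIV. curv i q (gradc F) i x)"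
    unfolding curv_def by (subst sum.swap) (simp add: ricci_def sum_distrib_right)
  also have "\<dots> = (\<Sum>i\<in>UNIV. covd i (hessmix F q) i x - covd q (hessmix F i) i x)"
  proof (rule sum.cong[OF refl])
    fix i
    have "covd i (covd q (gradc F)) i x = covd i (hessmix F q) i x"
      by (rule covd_cong[OF x]) (rule covd_gradc[OF F])
    moreover have "covd q (covd i (gradc F)) i x = covd q (hessmix F i) i x"
      by (rule covd_cong[OF x]) (rule covd_gradc[OF F])
    ultimately show "curv i q (gradc F) i x = covd i (hessmix F q) i x - covd q (hessmix F i) i x"
      using ricci_identity[OF smooth_gradc[OF F] x] by simp
  qed
  finally show ?thesis
    using F x by (simp add: div_mix_def covd_def sum_subtractf sum.distrib partial_sum[OF open_U] smooth_hessmix)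
qed


text \<open>Nonnegativity of \<open>\<bar>T\<bar>\<^sup>2\<close> for the traceless part \<open>T = Hess F - (\<Delta>F / n) h\<close>. This norm is the trace of
  \<open>h\<^sup>-\<^sup>1\<close> times \<open>N = T h\<^sup>-\<^sup>1 T\<^sup>t\<close>, and both matrices are positive semidefinite, so no orthonormal frame has to
  be chosen.\<close>

lemma trace_hess_squared_le:
  assumes F: "smooth_on U F" and x: "x \<in> U"
  shows "(\<Sum>i\<in>UNIV. hessmix F i i x)\<^sup>2
    \<le> real CARD('n) * (\<Sum>i\<in>UNIV. \<Sum>k\<in>UNIV. hessmix F i k x * hessmix F k i x)"
proof -
  define t where "t = (\<Sum>i\<in>UNIV. hessmix F i i x)"
  define c where "c = t / real CARD('n)"
  define T where "T i k = hess h F x $ i $ k - c * h x $ i $ k" for i k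
  define N where "N i j = (\<Sum>k\<in>UNIV. \<Sum>l\<in>UNIV. T i k * cometric k l x * T j l)" for i j
  define Tm where "Tm k i = (\<Sum>j\<in>UNIV. cometric i j x * T k j)" for k i
  have Tsym: "T i k = T k i" for i k
    by (simp add: T_def hess_sym[OF F x, of i k] h_sym[OF x, of i k])
  have Tm: "Tm k i = hessmix F k i x - c * of_bool (k = i)" for k i
  proof -
    have "(\<Sum>j\<in>UNIV. cometric i j x * h x $ k $ j) = of_bool (k = i)"
      using h_cometric[OF x, of k i] cometric_sym[OF x, of i] by (simp add: mult.commute)
    moreover have "Tm k i = hessmix F k i x - c * (\<Sum>j\<in>UNIV. cometric i j x * h x $ k $ j)"
      by (simp add: Tm_def T_def hessmix_def right_diff_distrib sum_subtractf sum_distrib_left ac_simps)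
    ultimately show ?thesis by (simp only:)
  qed
  have Npsd: "0 \<le> (\<Sum>i\<in>UNIV. \<Sum>j\<in>UNIV. N i j * v i * v j)" for v
  proof -
    define w where "w k = (\<Sum>i\<in>UNIV. T i k * v i)" for k
    have ww: "w k * w l = (\<Sum>i\<in>UNIV. \<Sum>j\<in>UNIV. (T i k * v i) * (T j l * v j))" for k l
      by (simp only: w_def sum_product)
    have "(\<Sum>i\<in>UNIV. \<Sum>j\<in>UNIV. N i j * v i * v j)
        = (\<Sum>i\<in>UNIV. \<Sum>j\<in>UNIV. \<Sum>k\<in>UNIV. \<Sum>l\<in>UNIV. cometric k l x * ((T i k * v i) * (T j l * v j)))"
      by (simp add: N_def sum_distrib_left sum_distrib_right ac_simps)
    also have "\<dots> = (\<Sum>i\<in>UNIV. \<Sum>k\<in>UNIV. \<Sum>j\<in>UNIV. \<Sum>l\<in>UNIV. cometric k l x * ((T i k * v i) * (T j l * v j)))"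
      by (intro sum.cong refl sum.swap)
    also have "\<dots> = (\<Sum>k\<in>UNIV. \<Sum>i\<in>UNIV. \<Sum>j\<in>UNIV. \<Sum>l\<in>UNIV. cometric k l x * ((T i k * v i) * (T j l * v j)))"
      by (rule sum.swap)
    also have "\<dots> = (\<Sum>k\<in>UNIV. \<Sum>i\<in>UNIV. \<Sum>l\<in>UNIV. \<Sum>j\<in>UNIV. cometric k l x * ((T i k * v i) * (T j l * v j)))"
      by (intro sum.cong refl sum.swap)
    also have "\<dots> = (\<Sum>k\<in>UNIV. \<Sum>l\<in>UNIV. \<Sum>i\<in>UNIV. \<Sum>j\<in>UNIV. cometric k l x * ((T i k * v i) * (T j l * v j)))"
      by (intro sum.cong refl sum.swap)
    also have "\<dots> = (\<Sum>k\<in>UNIV. \<Sum>l\<in>UNIV. cometric k l x * (w k * w l))"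
      by (simp only: ww sum_distrib_left)
    finally show ?thesis using cometric_psd[OF x, of w] by (simp only: mult.assoc)
  qed
  have "0 \<le> (\<Sum>i\<in>UNIV. \<Sum>j\<in>UNIV. cometric i j x * N i j)"
    by (rule sum_mult_psd_nonneg[OF finite_class.finite_UNIV cometric_sym[OF x] cometric_psd[OF x] Npsd])
  also have "\<dots> = (\<Sum>i\<in>UNIV. \<Sum>j\<in>UNIV. \<Sum>k\<in>UNIV. (cometric j i x * T k i) * Tm j k)"
    using cometric_sym[OF x] Tsym by (simp add: N_def Tm_def sum_distrib_left ac_simps)
  also have "\<dots> = (\<Sum>j\<in>UNIV. \<Sum>i\<in>UNIV. \<Sum>k\<in>UNIV. (cometric j i x * T k i) * Tm j k)"
    by (rule sum.swap)
  also have "\<dots> = (\<Sum>j\<in>UNIV. \<Sum>k\<in>UNIV. \<Sum>i\<in>UNIV. (cometric j i x * T k i) * Tm j k)"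
    by (intro sum.cong refl sum.swap)
  also have "\<dots> = (\<Sum>j\<in>UNIV. \<Sum>k\<in>UNIV. Tm k j * Tm j k)"
    by (simp add: Tm_def[of _ _] sum_distrib_right)
  also have "\<dots> = (\<Sum>i\<in>UNIV. \<Sum>k\<in>UNIV. hessmix F i k x * hessmix F k i x)
      - (\<Sum>j\<in>UNIV. \<Sum>k\<in>UNIV. c * (of_bool (k = j) * hessmix F j k x))
      - (\<Sum>j\<in>UNIV. \<Sum>k\<in>UNIV. c * (of_bool (j = k) * hessmix F k j x))
      + (\<Sum>j\<in>UNIV. \<Sum>k\<in>(UNIV::'n set). c * c * (of_bool (k = j) * 1))"
  proof -
    have "Tm k j * Tm j k = hessmix F j k x * hessmix F k j x - c * (of_bool (k = j) * hessmix F j k x)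
        - c * (of_bool (j = k) * hessmix F k j x) + c * c * (of_bool (k = j) * 1)" for j k
      by (cases "k = j") (simp_all add: Tm algebra_simps)
    then show ?thesis
      by (simp only: sum_subtractf sum.distrib)
  qed
  also have "\<dots> = (\<Sum>i\<in>UNIV. \<Sum>k\<in>UNIV. hessmix F i k x * hessmix F k i x) - c * t - c * t + c * c * real CARD('n)"
    unfolding sum_distrib_left[symmetric] sum_kronecker by (simp add: t_def)
  finally have "c * t \<le> (\<Sum>i\<in>UNIV. \<Sum>k\<in>UNIV. hessmix F i k x * hessmix F k i x)"
    by (simp add: c_def)
  then have "real CARD('n) * (c * t)
      \<le> real CARD('n) * (\<Sum>i\<in>UNIV. \<Sum>k\<in>UNIV. hessmix F i k x * hessmix F k i x)"
    by (rule mult_left_mono) simp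
  moreover have "real CARD('n) * (c * t) = t\<^sup>2" by (simp add: c_def power2_eq_square)
  ultimately show ?thesis by (simp only: t_def)
qed

text \<open>Where the first derivatives vanish, the Hessian consists of the second partial derivatives.\<close>

lemma local_max_divg_gradc:
  assumes W: "smooth_on U W" and x: "x \<in> U" and max: "\<And>y. y \<in> U \<Longrightarrow> W y \<le> W x"
  shows "divg (gradc W) x \<le> 0"
proof -
  have "0 \<le> (\<Sum>i\<in>UNIV. \<Sum>j\<in>UNIV. cometric i j x * (- partial i (partial j W) x))"
    using local_max_hessian(2)[OF open_U x W max]
    by (intro sum_mult_psd_nonneg[OF finite_class.finite_UNIV cometric_sym[OF x] cometric_psd[OF x]])
      (auto simp: sum_negf)
  moreover have "divg (gradc W) x = (\<Sum>i\<in>UNIV. \<Sum>j\<in>UNIV. cometric i j x * partial i (partial j W) x)"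
    by (simp add: divg_gradc[OF W x] hessmix_def hess_def local_max_hessian(1)[OF open_U x W max])
  ultimately show ?thesis by (simp add: sum_negf)
qed

lemma normsq_eq_inner: "normsq F x = (\<chi> i. partial i F x) \<bullet> (matrix_inv (h x) *v (\<chi> i. partial i F x))"
  by (simp add: normsq_def gradc_def inner_vec_def matrix_vector_mult_def cometric_def ac_simps)

lemma normsq_nonpos_imp:
  assumes x: "x \<in> U" and "normsq F x \<le> 0"
  shows "partial i F x = 0"
proof -
  let ?d = "\<chi> i. partial i F x" let ?w = "matrix_inv (h x) *v ?d"
  have d: "h x *v ?w = ?d"
    by (simp add: matrix_vector_mul_assoc matrix_inv_left_right[OF det_h[OF x]])
  have "?w = 0"
    using assms pos_h[OF x, of ?w] by (auto simp: d normsq_eq_inner inner_commute)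
  with d have "?d = 0" by simp
  then show ?thesis by (simp add: vec_eq_iff)
qed

lemma covd_add:
  assumes "\<And>l. smooth_on U (V l)" "\<And>l. smooth_on U (W l)" "x \<in> U"
  shows "covd p (\<lambda>l x. V l x + W l x) l x = covd p V l x + covd p W l x"
  using assms by (simp add: covd_def partial_add[of U] sum.distrib distrib_left)

end

text \<open>The soliton equation in one chart.\<close>

locale soliton_chart = metric_chart U h for U :: "(real^'n::finite) set" and h +
  fixes F :: "real^'n \<Rightarrow> real" and lam :: real
  assumes smooth_F: "smooth_on U F"
    and soliton: "x \<in> U \<Longrightarrow> ricci h x + hess h F x = lam *\<^sub>R h x"
begin

lemma ricmix_soliton: "x \<in> U \<Longrightarrow> ricmix p i x = lam * of_bool (p = i) - hessmix F p i x"
proof -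
  assume x: "x \<in> U"
  have e: "ricci h x $ p $ k = lam * h x $ p $ k - hess h F x $ p $ k" for k
    using arg_cong[OF soliton[OF x], of "\<lambda>M. M $ p $ k"] by simp
  have "ricmix p i x = lam * (\<Sum>k\<in>UNIV. h x $ p $ k * cometric k i x) - (\<Sum>k\<in>UNIV. hess h F x $ p $ k * cometric k i x)"
    by (simp add: ricmix_eq[OF x] e left_diff_distrib sum_subtractf sum_distrib_left mult.assoc)
  moreover have "(\<Sum>k\<in>UNIV. hess h F x $ p $ k * cometric k i x) = hessmix F p i x"
    using cometric_sym[OF x, of i] by (simp add: hessmix_def mult.commute)
  ultimately show ?thesis by (simp only: h_cometric[OF x])
qed

text \<open>The contracted Bianchi identity for \<open>Ric = \<lambda> h - Hess F\<close>; the metric is parallel, so only the Hessian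
  contributes.\<close>

lemma partial_trace_hess:
  assumes x: "x \<in> U"
  shows "partial p (\<lambda>y. \<Sum>i\<in>UNIV. hessmix F i i y) x = 2 * div_mix (hessmix F) p x"
proof -
  have sm: "smooth_on U (\<lambda>y. lam * of_bool (p = i) - hessmix F p i y)" for p i
    by (intro smooths smooth_hessmix smooth_F)
  have pr: "partial k (ricmix p i) x = - partial k (hessmix F p i) x" for k p i
  proof -
    have "partial k (ricmix p i) x = partial k (\<lambda>y. lam * of_bool (p = i) - hessmix F p i y) x"
      by (rule partial_cong_open[OF open_U x]) (rule ricmix_soliton)
    also have "\<dots> = - partial k (hessmix F p i) x"
      by (subst partial_diff[OF open_U smooth_on_const smooth_hessmix[OF smooth_F] x]) (simp add: partial_const)
    finally show ?thesis .
  qed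
  have c: "covd i (ricmix p) i x = lam * Gam i i p x - covd i (hessmix F p) i x" for i
    by (simp add: covd_def pr ricmix_soliton[OF x] right_diff_distrib sum_subtractf sum_kronecker
        mult.left_commute[of _ lam] flip: sum_distrib_left)
  have "(\<Sum>i\<in>UNIV. \<Sum>m\<in>UNIV. Gam i p m x * ricmix i m x)
      = lam * (\<Sum>i\<in>UNIV. Gam i i p x) - (\<Sum>i\<in>UNIV. \<Sum>m\<in>UNIV. Gam i p m x * hessmix F i m x)"
    by (simp add: ricmix_soliton[OF x] right_diff_distrib sum_subtractf sum_kronecker
        mult.left_commute[of _ lam] christoffel_sym[OF x, of _ p] flip: sum_distrib_left)
  then have "div_mix ricmix p x = - div_mix (hessmix F) p x"
    by (simp add: div_mix_def c sum_subtractf sum_distrib_left)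
  moreover have "partial p (\<lambda>y. \<Sum>i\<in>UNIV. ricmix i i y) x = - partial p (\<lambda>y. \<Sum>i\<in>UNIV. hessmix F i i y) x"
    using x by (simp add: partial_sum[OF open_U] smooth_ricmix smooth_hessmix smooth_F pr sum_negf)
  ultimately show ?thesis using contracted_bianchi[OF x, of p] by simp
qed

lemma ricci_grad_soliton: "x \<in> U \<Longrightarrow> (\<Sum>k\<in>UNIV. ricci h x $ q $ k * gradc F k x) = - div_mix (hessmix F) q x"
  using div_hessmix_commute[OF smooth_F, of x q] partial_trace_hess[of x q] by simp

lemma bochner:
  assumes x: "x \<in> U"
  shows "divg (gradc (normsq F)) x
    = 2 * ((\<Sum>i\<in>UNIV. \<Sum>k\<in>UNIV. hessmix F i k x * hessmix F k i x)
      - (\<Sum>q\<in>UNIV. gradc F q x * (\<Sum>k\<in>UNIV. ricci h x $ q $ k * gradc F k x)))"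
  by (simp add: divg_gradc_normsq[OF smooth_F x] ricci_grad_soliton[OF x] sum_negf)


text \<open>The maximum principle for \<open>u + \<epsilon> F\<^sup>2\<close>. With \<open>t = \<Delta>F\<close> and \<open>Q = \<bar>Hess F\<bar>\<^sup>2 \<ge> t\<^sup>2 / n\<close>, the Laplacian at the
  maximum satisfies \<open>2 Q + 2 \<epsilon> u + 2 \<epsilon> F t \<le> 0\<close>; multiplying by \<open>n\<close> and completing the square in \<open>t\<close> leaves
  the bound on \<open>u\<close>.\<close>

lemma normsq_le_at_max:
  assumes x: "x \<in> U" and eps: "eps > 0"
    and max: "\<And>y. y \<in> U \<Longrightarrow> normsq F y + eps * (F y * F y) \<le> normsq F x + eps * (F x * F x)"
    and ric: "(\<Sum>q\<in>UNIV. gradc F q x * (\<Sum>k\<in>UNIV. ricci h x $ q $ k * gradc F k x)) \<le> 0"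
  shows "normsq F x \<le> real CARD('n) * eps * (F x * F x) / 4"
proof -
  define W where "W = (\<lambda>y. normsq F y + eps * (F y * F y))"
  define n where "n = real CARD('n)"
  define t where "t = (\<Sum>i\<in>UNIV. hessmix F i i x)"
  define Q where "Q = (\<Sum>i\<in>UNIV. \<Sum>k\<in>UNIV. hessmix F i k x * hessmix F k i x)"
  have n: "n > 0" by (simp add: n_def)
  note sm = smooths smooth_gradc smooth_normsq smooth_F
  have smW: "smooth_on U W" unfolding W_def by (intro sm)
  have gW: "gradc W i y = gradc (normsq F) i y + (2 * eps * F y) * gradc F i y" if "y \<in> U" for i y
    using that by (simp add: gradc_def W_def partial_add[of U] partial_mult[of U] partial_const sm
        sum.distrib sum_distrib_left algebra_simps)
  have "divg (gradc W) x = divg (\<lambda>i y. gradc (normsq F) i y + (2 * eps * F y) * gradc F i y) x"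
    unfolding divg_def by (intro sum.cong refl covd_cong[OF x] gW)
  also have "\<dots> = divg (gradc (normsq F)) x + divg (\<lambda>i y. (2 * eps * F y) * gradc F i y) x"
    unfolding divg_def sum.distrib[symmetric] by (intro sum.cong refl covd_add sm x)
  also have "divg (\<lambda>i y. (2 * eps * F y) * gradc F i y) x = 2 * eps * normsq F x + 2 * eps * F x * t"
  proof -
    have "divg (\<lambda>i y. (2 * eps * F y) * gradc F i y) x
        = (\<Sum>i\<in>UNIV. partial i (\<lambda>y. 2 * eps * F y) x * gradc F i x) + 2 * eps * F x * divg (gradc F) x"
      by (intro divg_mult sm x)
    moreover have "partial i (\<lambda>y. 2 * eps * F y) x = 2 * eps * partial i F x" for i
      using x by (subst partial_mult[of U]) (auto simp: sm partial_const)
    ultimately show ?thesis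
      by (simp add: divg_gradc[OF smooth_F x] t_def normsq_def sum_distrib_left ac_simps)
  qed
  finally have "2 * Q + 2 * eps * normsq F x + 2 * eps * F x * t \<le> 0"
    using local_max_divg_gradc[OF smW x] max ric by (simp add: bochner[OF x] Q_def W_def)
  then have "n * (2 * Q + 2 * eps * normsq F x + 2 * eps * F x * t) \<le> 0"
    using n by (simp add: mult_le_0_iff)
  moreover have "t\<^sup>2 \<le> n * Q"
    using trace_hess_squared_le[OF smooth_F x] by (simp add: t_def n_def Q_def)
  moreover have "0 \<le> 2 * (t + n * eps * F x / 2)\<^sup>2" by simp
  ultimately have "2 * n * eps * normsq F x \<le> n * n * eps * eps * (F x * F x) / 2"
    by (simp add: power2_eq_square algebra_simps)
  then have "(2 * n * eps) * normsq F x \<le> (2 * n * eps) * (n * eps * (F x * F x) / 4)"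
    by (simp add: algebra_simps)
  then have "normsq F x \<le> n * eps * (F x * F x) / 4"
    using n eps by (simp only: mult_le_cancel_left_pos mult_pos_pos zero_less_numeral)
  then show ?thesis by (simp add: n_def)
qed

end

section \<open>From charts to the manifold\<close>

lemma chart_inv_left:
  assumes "chart_of X c" "p \<in> fst c"
  shows "chart_inv c (snd c p) = p"
proof -
  have "inj_on (snd c) (topspace (subtopology X (fst c)))"
    using assms(1) homeomorphic_imp_injective_map unfolding chart_of_def by blast
  moreover have "topspace (subtopology X (fst c)) = fst c"
    using assms(1) openin_subset unfolding chart_of_def by (metis topspace_subtopology_subset)
  ultimately show ?thesis using assms(2) by (simp add: chart_inv_def)
qed

lemma chart_continuous:
  assumes "chart_of X c"
  shows "continuous_map (subtopology X (fst c)) (top_of_set (chart_image c)) (snd c)"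
  using assms homeomorphic_imp_continuous_map unfolding chart_of_def by blast

lemma open_overlap:
  assumes c: "chart_of X c" and d: "chart_of X d"
  shows "open (overlap c d)"
proof -
  have "open_map (subtopology X (fst c)) (top_of_set (chart_image c)) (snd c)"
    using c homeomorphic_imp_open_map unfolding chart_of_def by blast
  moreover have "openin (subtopology X (fst c)) (fst c \<inter> fst d)"
    using c d unfolding chart_of_def by (simp add: openin_subtopology_Int2)
  ultimately have "openin (top_of_set (chart_image c)) (overlap c d)"
    unfolding open_map_def overlap_def by blast
  then show ?thesis using c unfolding chart_of_def by (metis openin_open_eq)
qed

lemma continuous_map_if_coord_rep:
  fixes w :: "'a \<Rightarrow> real" and A :: "('a, 'n::finite) chart set"
  assumes M: "smooth_manifold X A" and w: "\<And>c. c \<in> A \<Longrightarrow> continuous_on (chart_image c) (coord_rep w c)"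
  shows "continuous_map X euclideanreal w"
proof (rule pasting_lemma[where I = A and T = fst and f = "\<lambda>_. w"])
  fix c assume c: "c \<in> A"
  then have ch: "chart_of X c" using M unfolding smooth_manifold_def by blast
  then show "openin X (fst c)" unfolding chart_of_def by blast
  have "continuous_map (top_of_set (chart_image c)) euclideanreal (coord_rep w c)"
    using w[OF c] by simp
  from continuous_map_compose[OF chart_continuous[OF ch] this]
  show "continuous_map (subtopology X (fst c)) euclideanreal w"
    by (rule continuous_map_eq) (auto simp: coord_rep_def chart_inv_left[OF ch])
next
  fix p assume "p \<in> topspace X"
  then show "\<exists>c. c \<in> A \<and> p \<in> fst c \<and> w p = w p"
    using M unfolding smooth_manifold_def by blast
qed simp

lemma continuous_map_attains_max:
  fixes w :: "'a \<Rightarrow> real"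
  assumes "compact_space X" "topspace X \<noteq> {}" "continuous_map X euclideanreal w"
  obtains p where "p \<in> topspace X" "\<And>q. q \<in> topspace X \<Longrightarrow> w q \<le> w p"
proof -
  have "compact (w ` topspace X)"
    using image_compactin[of X "topspace X" euclideanreal w] assms(1,3)
    by (simp add: compact_space_def compactin_euclidean_iff)
  then obtain s where "s \<in> w ` topspace X" "\<And>t. t \<in> w ` topspace X \<Longrightarrow> t \<le> s"
    using compact_attains_sup[of "w ` topspace X"] assms(2) by blast
  then show ?thesis using that by blast
qed

lemma locally_constant_imp_constant:
  assumes "connected_space X"
    and loc: "\<And>p. p \<in> topspace X \<Longrightarrow> \<exists>T. openin X T \<and> p \<in> T \<and> (\<forall>q\<in>T. f q = f p)"
  shows "\<exists>a. \<forall>p\<in>topspace X. f p = a"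
proof (rule ccontr)
  assume neg: "\<not> ?thesis"
  then obtain p where p: "p \<in> topspace X" by blast
  with neg obtain q where q: "q \<in> topspace X" "f q \<noteq> f p" by blast
  have op: "openin X {r \<in> topspace X. P (f r)}" for P
  proof (subst openin_subopen, intro ballI)
    fix r assume "r \<in> {r \<in> topspace X. P (f r)}"
    then obtain T where T: "openin X T" "r \<in> T" "\<forall>q\<in>T. f q = f r" and P: "P (f r)" using loc by blast
    have "T \<subseteq> {r \<in> topspace X. P (f r)}"
    proof
      fix q assume q: "q \<in> T"
      then have "f q = f r" using T(3) by blast
      then show "q \<in> {r \<in> topspace X. P (f r)}" using P q openin_subset[OF T(1)] by auto
    qed
    then show "\<exists>T. openin X T \<and> r \<in> T \<and> T \<subseteq> {r \<in> topspace X. P (f r)}"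
      using T by blast
  qed
  let ?E = "{r \<in> topspace X. f r = f p}" and ?E' = "{r \<in> topspace X. f r \<noteq> f p}"
  have "topspace X \<subseteq> ?E \<union> ?E'" "?E \<inter> ?E' = {}" "?E \<noteq> {}" "?E' \<noteq> {}"
    using p q by auto
  then show False
    using assms(1) op[of "\<lambda>t. t = f p"] op[of "\<lambda>t. t \<noteq> f p"] unfolding connected_space_def by blast
qed

lemma partial_coord_rep:
  assumes cd: "chart_of X c" "chart_of X d" and x: "x \<in> overlap c d"
    and tr: "smooth_on (overlap c d) (transition c d)" and f: "smooth_on (chart_image d) (coord_rep f d)"
  shows "partial i (coord_rep f c) x
    = (transpose (matrix (frechet_derivative (transition c d) (at x))) *v
        (\<chi> k. partial k (coord_rep f d) (transition c d x))) $ i"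
proof -
  let ?t = "transition c d" let ?F = "coord_rep f d"
  have eq: "coord_rep f c y = (?F \<circ> ?t) y \<and> ?t y \<in> chart_image d" if "y \<in> overlap c d" for y
  proof -
    obtain p where p: "p \<in> fst c" "p \<in> fst d" "y = snd c p" using \<open>y \<in> overlap c d\<close> by (auto simp: overlap_def)
    then show ?thesis
      by (simp add: coord_rep_def transition_def chart_inv_left[OF cd(1)] chart_inv_left[OF cd(2)] chart_image_def)
  qed
  have D1: "(?t has_derivative frechet_derivative ?t (at x)) (at x)"
    using smooth_on_differentiable[OF tr x] by (simp add: frechet_derivative_works)
  have dF: "?F differentiable (at (?t x))"
    using smooth_on_differentiable[OF f] eq[OF x] by blast
  then have D2: "(?F has_derivative frechet_derivative ?F (at (?t x))) (at (?t x))"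
    by (simp add: frechet_derivative_works)
  have "partial i (coord_rep f c) x = partial i (?F \<circ> ?t) x"
    by (rule partial_cong_open[OF open_overlap[OF cd] x]) (use eq in blast)
  also have "\<dots> = frechet_derivative ?F (at (?t x)) (frechet_derivative ?t (at x) (axis i 1))"
    using frechet_derivative_at[OF diff_chain_at[OF D1 D2], symmetric] by (simp add: partial_def)
  also have "\<dots> = (\<Sum>k\<in>UNIV. frechet_derivative ?t (at x) (axis i 1) $ k * partial k ?F (?t x))"
    by (rule frechet_derivative_eq_sum_partial[OF dF])
  finally show ?thesis
    by (simp add: matrix_vector_mult_def transpose_def matrix_def)
qed

text \<open>The algebra behind the independence of \<open>\<bar>\<nabla>f\<bar>\<^sup>2\<close> of the chart: a covector and a metric transform by the
  same matrix \<open>J\<close>, whose invertibility is implied by that of the metric. The two gradients are related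
  by \<open>J\<close>.\<close>

lemma inner_inverse_congruence:
  fixes G G' J :: "real^'n^'n"
  assumes G: "G = transpose J ** G' ** J" and nz: "det G \<noteq> 0" "det G' \<noteq> 0" and a: "a = transpose J *v b"
  shows "a \<bullet> (matrix_inv G *v a) = b \<bullet> (matrix_inv G' *v b)"
proof -
  have inj: "x = y" if "K *v x = K *v y" "det K \<noteq> 0" for K :: "real^'n^'n" and x y
  proof -
    have "matrix_inv K *v (K *v x) = matrix_inv K *v (K *v y)" using that(1) by simp
    then show ?thesis using matrix_inv_left_right(1)[OF that(2)] by (simp add: matrix_vector_mul_assoc)
  qed
  have detJ: "det (transpose J) \<noteq> 0" using nz(1) by (auto simp: G det_mul det_transpose)
  let ?w = "matrix_inv G *v a"
  have "G *v ?w = a" using matrix_inv_left_right(2)[OF nz(1)] by (simp add: matrix_vector_mul_assoc)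
  then have "transpose J *v (G' *v (J *v ?w)) = transpose J *v b"
    by (simp add: G a matrix_vector_mul_assoc matrix_mul_assoc)
  then have "G' *v (J *v ?w) = b" by (rule inj[OF _ detJ])
  then have "G' *v (matrix_inv G' *v b) = G' *v (J *v ?w)"
    using matrix_inv_left_right(2)[OF nz(2)] by (simp add: matrix_vector_mul_assoc)
  then have w: "matrix_inv G' *v b = J *v ?w" by (rule inj[OF _ nz(2)])
  have "a \<bullet> ?w = b \<bullet> (J *v ?w)" using a dot_lmul_matrix[of b J ?w] by simp
  then show ?thesis by (simp add: w)
qed

theorem theorem1p1:
  fixes X :: "'a topology" and A :: "('a, 'n::finite) chart set"
    and g :: "('a, 'n) chart \<Rightarrow> real^'n \<Rightarrow> real^'n^'n"
    and f :: "'a \<Rightarrow> real" and lam :: real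
  assumes "gradient_ricci_soliton X A g f lam"
    and "compact_space X"
    and "\<And>c x. c \<in> A \<Longrightarrow> x \<in> chart_image c \<Longrightarrow> ricci_grad g f c x \<le> 0"
  shows "(\<exists>a. \<forall>p\<in>topspace X. f p = a) \<and> einstein A g lam"
proof -
  have M: "smooth_manifold X A" and R: "riemannian_metric A g" and f: "smooth_function A f"
    and sol: "\<And>c x. c \<in> A \<Longrightarrow> x \<in> chart_image c \<Longrightarrow>
      ricci (g c) x + hess (g c) (coord_rep f c) x = lam *\<^sub>R g c x"
    using assms(1) by (auto simp: gradient_ricci_soliton_def)
  have ch: "chart_of X c" if "c \<in> A" for c using M that unfolding smooth_manifold_def by blast
  have cover: "\<exists>c\<in>A. p \<in> fst c" if "p \<in> topspace X" for p
    using M that unfolding smooth_manifold_def by blast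
  have fst_sub: "fst c \<subseteq> topspace X" if "c \<in> A" for c
    using ch[OF that] unfolding chart_of_def by (simp add: openin_subset)
  have mc: "soliton_chart (chart_image c) (g c) (coord_rep f c) lam" if c: "c \<in> A" for c
  proof
    show "open (chart_image c)" using ch[OF c] by (simp add: chart_of_def)
    show "smooth_on (chart_image c) (coord_rep f c)" using f c by (simp add: smooth_function_def)
  qed (use R c sol in \<open>auto simp: riemannian_metric_def\<close>)
  note mm = soliton_chart.axioms(1)[OF mc]
  let ?N = "\<lambda>c x. metric_chart.normsq (g c) (coord_rep f c) x"
  have N_eq: "?N c (snd c p) = ?N d (snd d p)" if c: "c \<in> A" "p \<in> fst c" and d: "d \<in> A" "p \<in> fst d" for c d p
  proof -
    let ?x = "snd c p" let ?J = "matrix (frechet_derivative (transition c d) (at ?x))"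
    have x: "?x \<in> overlap c d" using that by (auto simp: overlap_def)
    have t: "transition c d ?x = snd d p" using c by (simp add: transition_def chart_inv_left[OF ch])
    have im: "?x \<in> chart_image c" "snd d p \<in> chart_image d" using c d by (auto simp: chart_image_def)
    have tr: "smooth_on (overlap c d) (transition c d)" using M c d by (simp add: smooth_manifold_def)
    have fd: "smooth_on (chart_image d) (coord_rep f d)" using f d by (simp add: smooth_function_def)
    have J: "g c ?x = transpose ?J ** g d (snd d p) ** ?J"
      using R c d x t unfolding riemannian_metric_def Let_def by metis
    have df: "(\<chi> i. partial i (coord_rep f c) ?x) = transpose ?J *v (\<chi> k. partial k (coord_rep f d) (snd d p))"
      using partial_coord_rep[OF ch[OF c(1)] ch[OF d(1)] x tr fd] by (simp add: vec_eq_iff t)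
    show ?thesis
      unfolding metric_chart.normsq_eq_inner[OF mm[OF c(1)]] metric_chart.normsq_eq_inner[OF mm[OF d(1)]]
      by (rule inner_inverse_congruence[OF J _ _ df])
        (use metric_chart.det_h[OF mm] c d im in auto)
  qed
  \<comment> \<open>\<open>\<bar>\<nabla>f\<bar>\<^sup>2\<close> as a function on the manifold; the chosen chart is irrelevant by \<open>N_eq\<close>.\<close>
  define u where "u p = ?N (SOME c. c \<in> A \<and> p \<in> fst c) (snd (SOME c. c \<in> A \<and> p \<in> fst c) p)" for p
  have u: "u p = ?N c (snd c p)" if "c \<in> A" "p \<in> fst c" for c p
  proof -
    have "(SOME c. c \<in> A \<and> p \<in> fst c) \<in> A \<and> p \<in> fst (SOME c. c \<in> A \<and> p \<in> fst c)"
      by (rule someI[of _ c]) (use that in blast)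
    then show ?thesis unfolding u_def using N_eq that by blast
  qed
  have u_rep: "coord_rep u c x = ?N c x \<and> (\<exists>p\<in>fst c. x = snd c p \<and> chart_inv c x = p)"
    if c: "c \<in> A" and x: "x \<in> chart_image c" for c x
  proof -
    obtain p where "p \<in> fst c" "x = snd c p" using x by (auto simp: chart_image_def)
    then show ?thesis using u[OF c] by (auto simp: coord_rep_def chart_inv_left[OF ch[OF c]])
  qed
  have cont_f: "continuous_on (chart_image c) (coord_rep f c)" if "c \<in> A" for c
    using f that by (simp add: smooth_function_def smooth_on_continuous_on)
  have cont_u: "continuous_on (chart_image c) (coord_rep u c)" if c: "c \<in> A" for c
  proof -
    have "continuous_on (chart_image c) (?N c)"
      using metric_chart.smooth_normsq[OF mm[OF c], of "coord_rep f c"] f c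
      by (simp add: smooth_function_def smooth_on_continuous_on)
    then show ?thesis using u_rep[OF c] by (simp cong: continuous_on_cong)
  qed
  have u_nonpos: "u q \<le> 0" if q: "q \<in> topspace X" for q
  proof -
    have ne: "topspace X \<noteq> {}" using q by blast
    have cf: "continuous_map X euclideanreal (\<lambda>p. (f p)\<^sup>2)"
      using continuous_map_if_coord_rep[OF M cont_f] by (intro continuous_intros)
    obtain p0 where "\<And>p. p \<in> topspace X \<Longrightarrow> (f p)\<^sup>2 \<le> (f p0)\<^sup>2"
      using continuous_map_attains_max[OF assms(2) ne cf] by blast
    then obtain C where C: "\<And>p. p \<in> topspace X \<Longrightarrow> (f p)\<^sup>2 \<le> C" by blast
    define K where "K = C * (real CARD('n) / 4 + 1)"
    \<comment> \<open>At a maximum \<open>p\<close> of \<open>?w = u + eps * f\<^sup>2\<close> both terms are of order \<open>eps\<close>, and \<open>u q \<le> ?w q \<le> ?w p\<close>.\<close>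
    have bound: "u q \<le> eps * K" if eps: "eps > 0" for eps
    proof -
      let ?w = "\<lambda>p. u p + eps * (f p * f p)"
      have cw: "continuous_map X euclideanreal ?w"
      proof (rule continuous_map_if_coord_rep[OF M])
        fix c assume c: "c \<in> A"
        have "continuous_on (chart_image c) (\<lambda>x. coord_rep u c x + eps * (coord_rep f c x * coord_rep f c x))"
          by (intro continuous_intros cont_f cont_u c)
        then show "continuous_on (chart_image c) (coord_rep ?w c)" by (simp add: coord_rep_def o_def)
      qed
      obtain p where p: "p \<in> topspace X" and max: "\<And>q. q \<in> topspace X \<Longrightarrow> ?w q \<le> ?w p"
        using continuous_map_attains_max[OF assms(2) ne cw] by blast
      obtain c where c: "c \<in> A" "p \<in> fst c" using cover[OF p] by blast
      interpret soliton_chart "chart_image c" "g c" "coord_rep f c" lam by (rule mc[OF c(1)])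
      let ?x = "snd c p"
      have x: "?x \<in> chart_image c" using c by (simp add: chart_image_def)
      have fx: "coord_rep f c ?x = f p" by (simp add: coord_rep_def chart_inv_left[OF ch[OF c(1)] c(2)])
      have "normsq (coord_rep f c) y + eps * (coord_rep f c y * coord_rep f c y)
          \<le> normsq (coord_rep f c) ?x + eps * (coord_rep f c ?x * coord_rep f c ?x)" if y: "y \<in> chart_image c" for y
      proof -
        obtain r where r: "r \<in> fst c" "y = snd c r" using y by (auto simp: chart_image_def)
        then have "coord_rep f c y = f r" by (simp add: coord_rep_def chart_inv_left[OF ch[OF c(1)]])
        then show ?thesis
          using max[of r] fst_sub[OF c(1)] r u[OF c(1), of r] u[OF c] by (auto simp: fx)
      qed
      moreover have "(\<Sum>q\<in>UNIV. gradc (coord_rep f c) q ?x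
          * (\<Sum>k\<in>UNIV. ricci (g c) ?x $ q $ k * gradc (coord_rep f c) k ?x)) \<le> 0"
      proof -
        have "grad (g c) (coord_rep f c) ?x = (\<chi> i. gradc (coord_rep f c) i ?x)"
          by (simp add: grad_def gradc_def cometric_def vec_eq_iff matrix_vector_mult_def mult.commute)
        then show ?thesis
          using assms(3)[OF c(1) x] by (simp add: ricci_grad_def Let_def inner_vec_def matrix_vector_mult_def)
      qed
      ultimately have "u p \<le> real CARD('n) * eps * (f p * f p) / 4"
        using normsq_le_at_max[OF x eps] u[OF c] fx by simp
      then have "?w p \<le> eps * ((real CARD('n) / 4 + 1) * (f p)\<^sup>2)"
        by (simp add: power2_eq_square algebra_simps)
      also have "\<dots> \<le> eps * ((real CARD('n) / 4 + 1) * C)"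
        using C[OF p] eps by (intro mult_left_mono) auto
      finally have "?w p \<le> eps * K" by (simp add: K_def mult.commute)
      then show ?thesis using max[OF q] eps by (smt (verit) mult_nonneg_nonneg zero_le_square)
    qed
    show ?thesis
    proof (rule ccontr)
      assume "\<not> ?thesis"
      then have pos: "u q > 0" by simp
      have K: "K > 0" using bound[of 1] pos by simp
      \<comment> \<open>For this \<open>eps\<close> the bound reads \<open>u q \<le> u q / 2\<close>.\<close>
      show False using bound[of "u q / (2 * K)"] pos K by simp
    qed
  qed
  have df: "partial i (coord_rep f c) x = 0" if c: "c \<in> A" and x: "x \<in> chart_image c" for c x i
  proof -
    obtain p where p: "p \<in> fst c" "x = snd c p" using x by (auto simp: chart_image_def)
    show ?thesis
      by (rule metric_chart.normsq_nonpos_imp[OF mm[OF c] x])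
        (use u_nonpos[of p] u[OF c p(1)] p fst_sub[OF c] in auto)
  qed
  have "\<exists>a. \<forall>p\<in>topspace X. f p = a"
  proof (rule locally_constant_imp_constant)
    show "connected_space X" using M by (simp add: smooth_manifold_def)
    fix p assume "p \<in> topspace X"
    then obtain c where c: "c \<in> A" "p \<in> fst c" using cover by blast
    have x: "snd c p \<in> chart_image c" using c by (simp add: chart_image_def)
    then obtain r where r: "r > 0" "ball (snd c p) r \<subseteq> chart_image c"
      using ch[OF c(1)] open_contains_ball unfolding chart_of_def by blast
    have "(coord_rep f c has_derivative (\<lambda>h. 0)) (at y within ball (snd c p) r)" if "y \<in> ball (snd c p) r" for y
    proof -
      have y: "y \<in> chart_image c" using that r by blast
      then have d: "coord_rep f c differentiable (at y)"
        using f c smooth_on_differentiable by (auto simp: smooth_function_def)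
      have "frechet_derivative (coord_rep f c) (at y) = (\<lambda>h. 0)"
        by (rule ext) (simp add: frechet_derivative_eq_sum_partial[OF d] df[OF c(1) y])
      then show ?thesis
        using d by (metis frechet_derivative_works has_derivative_at_withinI)
    qed
    from has_derivative_zero_constant[OF convex_ball this]
    obtain a where a: "\<And>y. y \<in> ball (snd c p) r \<Longrightarrow> coord_rep f c y = a" by blast
    let ?T = "{q \<in> topspace (subtopology X (fst c)). snd c q \<in> ball (snd c p) r}"
    have "openin (top_of_set (chart_image c)) (ball (snd c p) r)"
      using r(2) by (rule open_subset) simp
    then have "openin (subtopology X (fst c)) ?T"
      using chart_continuous[OF ch[OF c(1)]] by (rule openin_continuous_map_preimage[rotated])
    then have "openin X ?T"
      using ch[OF c(1)] unfolding chart_of_def by (meson openin_open_subtopology)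
    moreover have "p \<in> ?T" using c r \<open>p \<in> topspace X\<close> by simp
    moreover have "f q = f p" if "q \<in> ?T" for q
    proof -
      have "q \<in> fst c" using that by simp
      then have "f q = coord_rep f c (snd c q)" "f p = coord_rep f c (snd c p)"
        using c by (simp_all add: coord_rep_def chart_inv_left[OF ch[OF c(1)]])
      then show ?thesis using a[of "snd c q"] a[of "snd c p"] that r by simp
    qed
    ultimately show "\<exists>T. openin X T \<and> p \<in> T \<and> (\<forall>q\<in>T. f q = f p)" by blast
  qed
  moreover have "einstein A g lam"
    unfolding einstein_def
  proof (intro ballI)
    fix c x assume c: "c \<in> A" and x: "x \<in> chart_image c"
    have "partial i (partial j (coord_rep f c)) x = 0" for i j
    proof -
      have "partial i (partial j (coord_rep f c)) x = partial i (\<lambda>_. 0) x"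
        by (rule partial_cong_open[of "chart_image c"]) (use ch[OF c] x df[OF c] in \<open>auto simp: chart_of_def\<close>)
      then show ?thesis by (simp add: partial_const)
    qed
    then have "hess (g c) (coord_rep f c) x = 0"
      by (simp add: hess_def vec_eq_iff df[OF c x])
    then show "ricci (g c) x = lam *\<^sub>R g c x" using sol[OF c x] by simp
  qed
  ultimately show ?thesis by blast
qed

end
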